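(* Let $Z:\mathrm{dom}Z\subseteq\mathfrak H_{-,+}\to\mathfrak H_{+,-}$ be an impedance-type operator, let $\widetilde M:=M_{\mathrm{Gr}(-\mathrm iZ)}$, and let $V$ be a linear homeomorphism from $\mathfrak H$ onto $\mathfrak H_{-,+}$. The following are equivalent: (i) $\widehat M$ is an m-dissipative extension of $\widetilde M$; (ii) $\widehat M=M_\Theta$ with $\Theta=\{\{h_0,-\mathrm ih_1\}:\{h_0,h_1\}\in\Phi\}$ for some maximal accretive linear relation $\Phi$ from $\mathfrak H_{-,+}$ to $\mathfrak H_{+,-}$ containing $\mathrm{Gr}Z$; (iii) $\widehat M$ is the restriction of $M^*$ to the set of $\psi\in\mathrm{dom}M^*$ with $(I_{\mathfrak H}+K)V^{-1}\Gamma_0\psi-\mathrm i(I_{\mathfrak H}-K)V^\#\Gamma_1\psi=0$, for some contraction $K$ on $\mathfrak H$ which extends the Cayley transform $(T+\mathrm iI)(T-\mathrm iI)^{-1}$ of the dissipative operator $T:=-\mathrm iV^\#ZV$ in $\mathfrak H$.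
   Context: $A$ closed densely defined symmetric in Hilbert space $\mathfrak X$; $S$ bounded uniformly positive selfadjoint in $\mathfrak X\oplus\mathfrak X$; $\mathfrak X^{2,S}$ is $\mathfrak X\oplus\mathfrak X$ with inner product $(S\cdot|\cdot)$; $M\{\psi_1,\psi_2\}=S^{-1}\{\mathrm iA\psi_2,-\mathrm iA\psi_1\}$ on $(\mathrm{dom}A)^2$, with adjoint $M^*$ given by the same formula with $A^*$ on $(\mathrm{dom}A^* )^2$. Mixed-order duality: $\mathfrak H_{-,+},\mathfrak H_{+,-}$ are Hilbert spaces such that $\widetilde{\mathfrak H}_{\mp,\pm}:=\mathfrak H\cap\mathfrak H_{\mp,\pm}$ is dense in $\mathfrak H$ and in $\mathfrak H_{\mp,\pm}$, the form $\|h\|^2_{\mathfrak H_{\mp,\pm}}$ on $\widetilde{\mathfrak H}_{\mp,\pm}$ is closed in $\mathfrak H$, and $\|h\|_{\mathfrak H_{\pm,\mp}}=\sup_{0\ne g\in\widetilde{\mathfrak H}_{\mp,\pm}}|(g|h)_{\mathfrak H}|/\|g\|_{\mathfrak H_{\mp,\pm}}$ for $h\in\widetilde{\mathfrak H}_{\pm,\mp}$. $\langle\cdot|\cdot\rangle_{\mathfrak H}$ is the unique bounded sesquilinear extension of $(\cdot|\cdot)_{\mathfrak H}$ from $\widetilde{\mathfrak H}_{-,+}\times\widetilde{\mathfrak H}_{+,-}$ to $\mathfrak H_{-,+}\times\mathfrak H_{+,-}$, with $\langle h_{+,-}|h_{-,+}\rangle_{\mathfrak H}:=\overline{\langle h_{-,+}|h_{+,-}\rangle_{\mathfrak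 H}}$. A reduction tuple $(\mathfrak H_{-,+},\mathfrak H,G,W)$ for $A^*$: $G:\mathrm{dom}A^*\to\mathfrak H_{-,+}$ is linear and surjective, $W:\mathfrak H_{-,+}\to\mathfrak H_{+,-}$ is a linear homeomorphism, and $(A^*f|g)_{\mathfrak X}-(f|A^*g)_{\mathfrak X}=\langle Gf|WGg\rangle_{\mathfrak H}$ for all $f,g\in\mathrm{dom}A^*$. Fix such a tuple and set $\Gamma_0\psi:=G\psi_2$, $\Gamma_1\psi:=\mathrm iWG\psi_1$ for $\psi=\{\psi_1,\psi_2\}\in\mathrm{dom}M^*$. A linear relation $\Phi$ from $\mathfrak H_{-,+}$ to $\mathfrak H_{+,-}$ (subspace of $\mathfrak H_{-,+}\oplus\mathfrak H_{+,-}$) is accretive if $\mathrm{Re}\langle h_1|h_0\rangle_{\mathfrak H}\ge0$ for all $\{h_0,h_1\}\in\Phi$, dissipative if $\mathrm{Im}\langle h_1|h_0\rangle_{\mathfrak H}\le0$, maximal if it has no proper extension of the same class; an operator is accretive if its graph is. An impedance-type operator is an accretive operator $Z:\mathrm{dom}Z\subseteq\mathfrak H_{-,+}\to\mathfrak H_{+,-}$. For a linear relation $\Theta$, $M_\Theta$ is the restriction of $M^*$ to $\{\psi\in\mathrm{dom}M^*:\{\Gamma_0\psi,\Gamma_1\psi\}\in\Theta\}$; thus $M_{\mathrm{Gr}(-\mathrm iZ)}$ is defined by $\mathrm iZ\Gamma_0\psi+\Gamma_1\psi=0$. $V^\#:\mathfrak H_{+,-}\to\mathfrak H$ is defined by $\langle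 Vf|g\rangle_{\mathfrak H}=(f|V^\#g)_{\mathfrak H}$ ($f\in\mathfrak H$, $g\in\mathfrak H_{+,-}$). A contraction on $\mathfrak H$ is an everywhere defined operator of norm $\le1$; extension means graph inclusion; m-dissipative as usual. *)

theory Defs
  imports Complex_Main "HOL-Library.Product_Plus"
begin

class cvec = ab_group_add +
  fixes cscale :: "complex \<Rightarrow> 'a \<Rightarrow> 'a"  (infixr "*\<^sub>C" 75)
  assumes cscale_add_right: "cscale a (x + y) = cscale a x + cscale a y"
    and cscale_add_left: "cscale (a + b) x = cscale a x + cscale b x"
    and cscale_cscale: "cscale a (cscale b x) = cscale (a * b) x"
    and cscale_one: "cscale 1 x = x"

instantiation prod :: (cvec, cvec) cvec
begin
definition cscale_prod_def: "cscale c p = (cscale c (fst p), cscale c (snd p))"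
instance
  by standard (auto simp: cscale_prod_def cscale_add_right cscale_add_left cscale_cscale cscale_one)
end

definition csubspace :: "'a::cvec set \<Rightarrow> bool" where
  "csubspace V \<longleftrightarrow> 0 \<in> V \<and> (\<forall>x\<in>V. \<forall>y\<in>V. x + y \<in> V) \<and> (\<forall>c. \<forall>x\<in>V. c *\<^sub>C x \<in> V)"

definition inner_prod_on :: "'a::cvec set \<Rightarrow> ('a \<Rightarrow> 'a \<Rightarrow> complex) \<Rightarrow> bool" where
  "inner_prod_on V ip \<longleftrightarrow> csubspace V
     \<and> (\<forall>x\<in>V. \<forall>y\<in>V. \<forall>z\<in>V. ip (x + y) z = ip x z + ip y z)
     \<and> (\<forall>c. \<forall>x\<in>V. \<forall>y\<in>V. ip (c *\<^sub>C x) y = c * ip x y)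
     \<and> (\<forall>x\<in>V. \<forall>y\<in>V. ip y x = cnj (ip x y))
     \<and> (\<forall>x\<in>V. 0 \<le> Re (ip x x))
     \<and> (\<forall>x\<in>V. ip x x = 0 \<longrightarrow> x = 0)"

definition ipnorm :: "('a \<Rightarrow> 'a \<Rightarrow> complex) \<Rightarrow> 'a \<Rightarrow> real" where
  "ipnorm ip x = sqrt (Re (ip x x))"

definition ip_cauchy :: "('a::cvec \<Rightarrow> 'a \<Rightarrow> complex) \<Rightarrow> (nat \<Rightarrow> 'a) \<Rightarrow> bool" where
  "ip_cauchy ip s \<longleftrightarrow> (\<forall>e>0. \<exists>N. \<forall>m\<ge>N. \<forall>n\<ge>N. ipnorm ip (s m - s n) < e)"

definition ip_conv :: "('a::cvec \<Rightarrow> 'a \<Rightarrow> complex) \<Rightarrow> (nat \<Rightarrow> 'a) \<Rightarrow> 'a \<Rightarrow> bool" where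
  "ip_conv ip s l \<longleftrightarrow> (\<lambda>n. ipnorm ip (s n - l)) \<longlonglongrightarrow> 0"

definition hilbert_space :: "'a::cvec set \<Rightarrow> ('a \<Rightarrow> 'a \<Rightarrow> complex) \<Rightarrow> bool" where
  "hilbert_space V ip \<longleftrightarrow> inner_prod_on V ip
     \<and> (\<forall>s. (\<forall>n. s n \<in> V) \<and> ip_cauchy ip s \<longrightarrow> (\<exists>l\<in>V. ip_conv ip s l))"

definition ip_dense :: "('a::cvec \<Rightarrow> 'a \<Rightarrow> complex) \<Rightarrow> 'a set \<Rightarrow> 'a set \<Rightarrow> bool" where
  "ip_dense ip V D \<longleftrightarrow> D \<subseteq> V \<and> (\<forall>x\<in>V. \<forall>e>0. \<exists>y\<in>D. ipnorm ip (x - y) < e)"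

text \<open>The (nonnegative) form \<open>q[h] = ipnorm ipq h ^ 2\<close> with domain \<open>D\<close> is closed in the Hilbert space
  \<open>(H, ipH)\<close> (standard definition of a closed form).\<close>
definition closed_form_in ::
  "('a::cvec \<Rightarrow> 'a \<Rightarrow> complex) \<Rightarrow> 'a set \<Rightarrow> ('a \<Rightarrow> 'a \<Rightarrow> complex) \<Rightarrow> 'a set \<Rightarrow> bool" where
  "closed_form_in ipH H ipq D \<longleftrightarrow> D \<subseteq> H \<and>
     (\<forall>s h. (\<forall>n. s n \<in> D) \<and> h \<in> H \<and> ip_conv ipH s h \<and> ip_cauchy ipq s
        \<longrightarrow> h \<in> D \<and> ip_conv ipq s h)"

text \<open>\<open>s\<close> is the supremum of the set \<open>S\<close> of nonnegative reals (sup of the empty set being 0).\<close>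
definition is_sup_nonneg :: "real \<Rightarrow> real set \<Rightarrow> bool" where
  "is_sup_nonneg s S \<longleftrightarrow> (\<forall>x\<in>S. x \<le> s) \<and> (\<forall>b\<ge>0. (\<forall>x\<in>S. x \<le> b) \<longrightarrow> s \<le> b)"

text \<open>Mixed-order duality \<open>H_{-,+}\<close> (carrier \<open>Hmp\<close>), \<open>H\<close>, \<open>H_{+,-}\<close> (carrier \<open>Hpm\<close>), all living in
  a common ambient complex vector space.\<close>
definition mixed_duality ::
  "'h::cvec set \<Rightarrow> ('h \<Rightarrow> 'h \<Rightarrow> complex) \<Rightarrow> 'h set \<Rightarrow> ('h \<Rightarrow> 'h \<Rightarrow> complex)
     \<Rightarrow> 'h set \<Rightarrow> ('h \<Rightarrow> 'h \<Rightarrow> complex) \<Rightarrow> bool" where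
  "mixed_duality H ipH Hmp ipmp Hpm ippm \<longleftrightarrow>
     hilbert_space H ipH \<and> hilbert_space Hmp ipmp \<and> hilbert_space Hpm ippm
   \<and> ip_dense ipH H (H \<inter> Hmp) \<and> ip_dense ipmp Hmp (H \<inter> Hmp)
   \<and> ip_dense ipH H (H \<inter> Hpm) \<and> ip_dense ippm Hpm (H \<inter> Hpm)
   \<and> closed_form_in ipH H ipmp (H \<inter> Hmp) \<and> closed_form_in ipH H ippm (H \<inter> Hpm)
   \<and> (\<forall>h\<in>H \<inter> Hpm. is_sup_nonneg (ipnorm ippm h)
         {cmod (ipH g h) / ipnorm ipmp g | g. g \<in> H \<inter> Hmp \<and> g \<noteq> 0})
   \<and> (\<forall>h\<in>H \<inter> Hmp. is_sup_nonneg (ipnorm ipmp h)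
         {cmod (ipH g h) / ipnorm ippm g | g. g \<in> H \<inter> Hpm \<and> g \<noteq> 0})"

text \<open>\<open>p a b = \<langle>a|b\<rangle>_H\<close> for \<open>a \<in> H_{-,+}\<close>, \<open>b \<in> H_{+,-}\<close>: the bounded sesquilinear extension of
  \<open>(\<cdot>|\<cdot>)_H\<close> from \<open>H~_{-,+} \<times> H~_{+,-}\<close> (unique by density). \<open>\<langle>b|a\<rangle>_H := cnj (p a b)\<close>.\<close>
definition duality_pairing ::
  "'h::cvec set \<Rightarrow> ('h \<Rightarrow> 'h \<Rightarrow> complex) \<Rightarrow> 'h set \<Rightarrow> ('h \<Rightarrow> 'h \<Rightarrow> complex)
     \<Rightarrow> 'h set \<Rightarrow> ('h \<Rightarrow> 'h \<Rightarrow> complex) \<Rightarrow> ('h \<Rightarrow> 'h \<Rightarrow> complex) \<Rightarrow> bool" where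
  "duality_pairing H ipH Hmp ipmp Hpm ippm p \<longleftrightarrow>
     (\<forall>a\<in>Hmp. \<forall>a'\<in>Hmp. \<forall>b\<in>Hpm. p (a + a') b = p a b + p a' b)
   \<and> (\<forall>c. \<forall>a\<in>Hmp. \<forall>b\<in>Hpm. p (c *\<^sub>C a) b = c * p a b)
   \<and> (\<forall>a\<in>Hmp. \<forall>b\<in>Hpm. \<forall>b'\<in>Hpm. p a (b + b') = p a b + p a b')
   \<and> (\<forall>c. \<forall>a\<in>Hmp. \<forall>b\<in>Hpm. p a (c *\<^sub>C b) = cnj c * p a b)
   \<and> (\<exists>C. \<forall>a\<in>Hmp. \<forall>b\<in>Hpm. cmod (p a b) \<le> C * ipnorm ipmp a * ipnorm ippm b)
   \<and> (\<forall>a\<in>H \<inter> Hmp. \<forall>b\<in>H \<inter> Hpm. p a b = ipH a b)"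

definition clinear_on :: "'a::cvec set \<Rightarrow> ('a \<Rightarrow> 'b::cvec) \<Rightarrow> bool" where
  "clinear_on A f \<longleftrightarrow> (\<forall>x\<in>A. \<forall>y\<in>A. f (x + y) = f x + f y) \<and> (\<forall>c. \<forall>x\<in>A. f (c *\<^sub>C x) = c *\<^sub>C f x)"

definition bounded_on :: "('a \<Rightarrow> 'a \<Rightarrow> complex) \<Rightarrow> 'a set \<Rightarrow> ('b \<Rightarrow> 'b \<Rightarrow> complex) \<Rightarrow> ('a \<Rightarrow> 'b) \<Rightarrow> bool" where
  "bounded_on ipA A ipB f \<longleftrightarrow> (\<exists>C. \<forall>x\<in>A. ipnorm ipB (f x) \<le> C * ipnorm ipA x)"

definition lin_homeo ::
  "('a::cvec \<Rightarrow> 'a \<Rightarrow> complex) \<Rightarrow> 'a set \<Rightarrow> ('b::cvec \<Rightarrow> 'b \<Rightarrow> complex) \<Rightarrow> 'b set \<Rightarrow> ('a \<Rightarrow> 'b) \<Rightarrow> bool" where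
  "lin_homeo ipA A ipB B f \<longleftrightarrow> clinear_on A f \<and> f ` A = B \<and> inj_on f A
     \<and> bounded_on ipA A ipB f \<and> bounded_on ipB B ipA (inv_into A f)"

definition graph :: "'a set \<Rightarrow> ('a \<Rightarrow> 'b) \<Rightarrow> ('a \<times> 'b) set" where
  "graph D f = {(x, f x) | x. x \<in> D}"

definition closed_op :: "('a::cvec \<Rightarrow> 'a \<Rightarrow> complex) \<Rightarrow> 'a set \<Rightarrow> ('a \<Rightarrow> 'a) \<Rightarrow> bool" where
  "closed_op ip D T \<longleftrightarrow> (\<forall>s f g. (\<forall>n. s n \<in> D) \<and> ip_conv ip s f \<and> ip_conv ip (\<lambda>n. T (s n)) g
       \<longrightarrow> f \<in> D \<and> T f = g)"

definition closed_dd_symmetric :: "('a::cvec \<Rightarrow> 'a \<Rightarrow> complex) \<Rightarrow> 'a set \<Rightarrow> ('a \<Rightarrow> 'a) \<Rightarrow> bool" where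
  "closed_dd_symmetric ip D T \<longleftrightarrow> csubspace D \<and> clinear_on D T \<and> ip_dense ip UNIV D
     \<and> closed_op ip D T \<and> (\<forall>f\<in>D. \<forall>g\<in>D. ip (T f) g = ip f (T g))"

definition adj_dom :: "('a \<Rightarrow> 'a \<Rightarrow> complex) \<Rightarrow> 'a set \<Rightarrow> ('a \<Rightarrow> 'a) \<Rightarrow> 'a set" where
  "adj_dom ip D T = {g. \<exists>h. \<forall>f\<in>D. ip (T f) g = ip f h}"

definition adj :: "('a \<Rightarrow> 'a \<Rightarrow> complex) \<Rightarrow> 'a set \<Rightarrow> ('a \<Rightarrow> 'a) \<Rightarrow> 'a \<Rightarrow> 'a" where
  "adj ip D T g = (THE h. \<forall>f\<in>D. ip (T f) g = ip f h)"

definition ip2 :: "('x \<Rightarrow> 'x \<Rightarrow> complex) \<Rightarrow> 'x \<times> 'x \<Rightarrow> 'x \<times> 'x \<Rightarrow> complex" where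
  "ip2 ip u v = ip (fst u) (fst v) + ip (snd u) (snd v)"

definition ipS :: "('x \<Rightarrow> 'x \<Rightarrow> complex) \<Rightarrow> ('x \<times> 'x \<Rightarrow> 'x \<times> 'x) \<Rightarrow> 'x \<times> 'x \<Rightarrow> 'x \<times> 'x \<Rightarrow> complex" where
  "ipS ip S u v = ip2 ip (S u) v"

definition bdd_unif_pos_sa :: "('x::cvec \<Rightarrow> 'x \<Rightarrow> complex) \<Rightarrow> ('x \<times> 'x \<Rightarrow> 'x \<times> 'x) \<Rightarrow> bool" where
  "bdd_unif_pos_sa ip S \<longleftrightarrow> clinear_on UNIV S \<and> bounded_on (ip2 ip) UNIV (ip2 ip) S
     \<and> (\<forall>u v. ip2 ip (S u) v = ip2 ip u (S v))
     \<and> (\<exists>c>0. \<forall>u. c * (ipnorm (ip2 ip) u)\<^sup>2 \<le> Re (ip2 ip (S u) u))"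

definition Mst_dom :: "('x \<Rightarrow> 'x \<Rightarrow> complex) \<Rightarrow> 'x set \<Rightarrow> ('x \<Rightarrow> 'x) \<Rightarrow> ('x \<times> 'x) set" where
  "Mst_dom ip D A = adj_dom ip D A \<times> adj_dom ip D A"

definition Mst :: "('x::cvec \<Rightarrow> 'x \<Rightarrow> complex) \<Rightarrow> 'x set \<Rightarrow> ('x \<Rightarrow> 'x) \<Rightarrow> ('x \<times> 'x \<Rightarrow> 'x \<times> 'x)
     \<Rightarrow> 'x \<times> 'x \<Rightarrow> 'x \<times> 'x" where
  "Mst ip D A S \<psi> = inv S (\<i> *\<^sub>C adj ip D A (snd \<psi>), - (\<i> *\<^sub>C adj ip D A (fst \<psi>)))"

text \<open>Graph of \<open>M_\<Theta>\<close>: restriction of \<open>M^*\<close> to \<open>{\<psi>. {\<Gamma>0 \<psi>, \<Gamma>1 \<psi>} \<in> \<Theta>}\<close>, where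
  \<open>\<Gamma>0 \<psi> = G \<psi>2\<close>, \<open>\<Gamma>1 \<psi> = i W G \<psi>1\<close>.\<close>
definition MTheta :: "('x::cvec \<Rightarrow> 'x \<Rightarrow> complex) \<Rightarrow> 'x set \<Rightarrow> ('x \<Rightarrow> 'x) \<Rightarrow> ('x \<times> 'x \<Rightarrow> 'x \<times> 'x)
     \<Rightarrow> ('x \<Rightarrow> 'h::cvec) \<Rightarrow> ('h \<Rightarrow> 'h) \<Rightarrow> ('h \<times> 'h) set \<Rightarrow> (('x \<times> 'x) \<times> ('x \<times> 'x)) set" where
  "MTheta ip D A S G W \<Theta> = {(\<psi>, Mst ip D A S \<psi>) | \<psi>.
      \<psi> \<in> Mst_dom ip D A \<and> (G (snd \<psi>), \<i> *\<^sub>C W (G (fst \<psi>))) \<in> \<Theta>}"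

definition reduction_tuple where
  "reduction_tuple ip D A Hmp ipmp Hpm ippm p G W \<longleftrightarrow>
     clinear_on (adj_dom ip D A) G \<and> G ` adj_dom ip D A = Hmp
   \<and> lin_homeo ipmp Hmp ippm Hpm W
   \<and> (\<forall>f\<in>adj_dom ip D A. \<forall>g\<in>adj_dom ip D A.
        ip (adj ip D A f) g - ip f (adj ip D A g) = p (G f) (W (G g)))"

definition linrel :: "'h::cvec set \<Rightarrow> 'h set \<Rightarrow> ('h \<times> 'h) set \<Rightarrow> bool" where
  "linrel Hmp Hpm \<Phi> \<longleftrightarrow> csubspace \<Phi> \<and> \<Phi> \<subseteq> Hmp \<times> Hpm"

definition accretive_rel :: "('h \<Rightarrow> 'h \<Rightarrow> complex) \<Rightarrow> ('h \<times> 'h) set \<Rightarrow> bool" where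
  "accretive_rel p \<Phi> \<longleftrightarrow> (\<forall>(h0, h1)\<in>\<Phi>. 0 \<le> Re (cnj (p h0 h1)))"

definition max_accretive_rel :: "'h::cvec set \<Rightarrow> 'h set \<Rightarrow> ('h \<Rightarrow> 'h \<Rightarrow> complex) \<Rightarrow> ('h \<times> 'h) set \<Rightarrow> bool" where
  "max_accretive_rel Hmp Hpm p \<Phi> \<longleftrightarrow> linrel Hmp Hpm \<Phi> \<and> accretive_rel p \<Phi>
     \<and> (\<forall>\<Psi>. linrel Hmp Hpm \<Psi> \<and> accretive_rel p \<Psi> \<and> \<Phi> \<subseteq> \<Psi> \<longrightarrow> \<Psi> = \<Phi>)"

definition impedance_op :: "'h::cvec set \<Rightarrow> 'h set \<Rightarrow> ('h \<Rightarrow> 'h \<Rightarrow> complex) \<Rightarrow> 'h set \<Rightarrow> ('h \<Rightarrow> 'h) \<Rightarrow> bool" where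
  "impedance_op Hmp Hpm p DZ Z \<longleftrightarrow> csubspace DZ \<and> DZ \<subseteq> Hmp \<and> Z ` DZ \<subseteq> Hpm \<and> clinear_on DZ Z
     \<and> accretive_rel p (graph DZ Z)"

definition vsharp :: "'h set \<Rightarrow> ('h \<Rightarrow> 'h \<Rightarrow> complex) \<Rightarrow> ('h \<Rightarrow> 'h \<Rightarrow> complex) \<Rightarrow> ('h \<Rightarrow> 'h) \<Rightarrow> 'h \<Rightarrow> 'h" where
  "vsharp H ipH p V g = (THE u. u \<in> H \<and> (\<forall>f\<in>H. p (V f) g = ipH f u))"

definition op_graph :: "('a::cvec \<times> 'a) set \<Rightarrow> bool" where
  "op_graph Gr \<longleftrightarrow> csubspace Gr \<and> (\<forall>x y z. (x, y) \<in> Gr \<and> (x, z) \<in> Gr \<longrightarrow> y = z)"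

definition m_dissipative :: "('a::cvec \<Rightarrow> 'a \<Rightarrow> complex) \<Rightarrow> ('a \<times> 'a) set \<Rightarrow> bool" where
  "m_dissipative ip Gr \<longleftrightarrow> op_graph Gr \<and> (\<forall>(x, y)\<in>Gr. Im (ip y x) \<le> 0)
     \<and> (\<exists>l. Im l > 0 \<and> (\<forall>z. \<exists>x y. (x, y) \<in> Gr \<and> y - l *\<^sub>C x = z))"

end

theory Submission
  imports Defs
begin

text \<open>
  Every dissipative relation extending the symmetric operator \<open>M\<close> is a restriction of \<open>M\<^sup>*\<close>, and by
  Green's identity \<open>Im (M\<^sup>*\<psi> | \<psi>)\<^sub>S = - Re \<langle>h\<^sub>1 | h\<^sub>0\<rangle>\<close> for the boundary values
  \<open>h\<^sub>0 = G \<psi>\<^sub>2\<close>, \<open>h\<^sub>1 = - W G \<psi>\<^sub>1\<close>. As these range over all of \<open>H\<^sub>-\<^sub>+ \<times> H\<^sub>+\<^sub>-\<close>, maximal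
  dissipative extensions of \<open>M\<close> correspond to maximal accretive relations \<open>\<Phi>\<close>. The bijection
  \<open>(h\<^sub>0, h\<^sub>1) \<mapsto> (V\<^sup>-\<^sup>1 h\<^sub>0, - \<i> V\<^sup>\<sharp> h\<^sub>1)\<close> turns the latter into maximal dissipative relations in the
  Hilbert space \<open>H\<close>, whose Cayley transforms are exactly the contractions on \<open>H\<close>. On both sides
  maximality is equivalent to surjectivity of \<open>R - \<i>\<close>, because a Cayley transform that is not
  everywhere defined can be extended by \<open>0\<close>.
\<close>

section \<open>Hilbert spaces on carrier sets\<close>

text \<open>Maximality is compared between relations rather than operators: a contraction
  \<open>K\<close> with nonzero fixed vectors has a multivalued inverse Cayley transform. On the
  side of \<open>M\<close> single-valuedness comes for free, since only pairs
  \<open>(\<psi>, Ms \<psi>)\<close> occur. The weighted space and \<open>H\<close> are two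
  instances of one locale, so the argument about the range of \<open>R - \<i>\<close> is made once.
  It needs an orthogonal projection onto that range, hence completeness of the range. Closedness of
  \<open>R\<close> is not assumed but extracted from maximality: the closure of a dissipative
  relation is dissipative. The range is then complete because \<open>R - \<i>\<close> is bounded
  below on \<open>R\<close>. The other delicate point is that \<open>V#\<close> maps onto
  \<open>H\<close>. The lower bound for it comes from the supremum formulas for the norms, which are
  given only on intersections with \<open>H\<close> and must first be carried over to the whole
  spaces by density. The weight \<open>S\<close> affects completeness only: in the form of
  \<open>M*\<close> it cancels against the inverse of \<open>S\<close> in the definition of
  \<open>Mst\<close>.\<close>

interpretation cvec: vector_space "cscale :: complex \<Rightarrow> 'a::cvec \<Rightarrow> 'a"
  by standard (simp_all add: cscale_add_right cscale_add_left cscale_cscale cscale_one)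

lemma csubspace_mem:
  assumes "csubspace V"
  shows csubspace_zero: "0 \<in> V"
    and csubspace_add: "\<And>x y. x \<in> V \<Longrightarrow> y \<in> V \<Longrightarrow> x + y \<in> V"
    and csubspace_scale: "\<And>c x. x \<in> V \<Longrightarrow> c *\<^sub>C x \<in> V"
    and csubspace_uminus: "\<And>x. x \<in> V \<Longrightarrow> - x \<in> V"
    and csubspace_diff: "\<And>x y. x \<in> V \<Longrightarrow> y \<in> V \<Longrightarrow> x - y \<in> V"
proof -
  show *: "0 \<in> V" "\<And>x y. x \<in> V \<Longrightarrow> y \<in> V \<Longrightarrow> x + y \<in> V" "\<And>c x. x \<in> V \<Longrightarrow> c *\<^sub>C x \<in> V"
    using assms unfolding csubspace_def by auto
  show m: "- x \<in> V" if "x \<in> V" for x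
    using *(3)[OF that, of "-1"] by simp
  show "x - y \<in> V" if "x \<in> V" "y \<in> V" for x y
    using *(2)[OF that(1) m[OF that(2)]] by simp
qed

lemma csubspace_UNIV [simp]: "csubspace UNIV"
  by (simp add: csubspace_def)

lemma clinear_on_mem:
  assumes "clinear_on V f" "csubspace V"
  shows clinear_on_add: "\<And>x y. x \<in> V \<Longrightarrow> y \<in> V \<Longrightarrow> f (x + y) = f x + f y"
    and clinear_on_scale: "\<And>c x. x \<in> V \<Longrightarrow> f (c *\<^sub>C x) = c *\<^sub>C f x"
    and clinear_on_zero: "f 0 = 0"
    and clinear_on_uminus: "\<And>x. x \<in> V \<Longrightarrow> f (- x) = - f x"
    and clinear_on_diff: "\<And>x y. x \<in> V \<Longrightarrow> y \<in> V \<Longrightarrow> f (x - y) = f x - f y"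
proof -
  show *: "\<And>x y. x \<in> V \<Longrightarrow> y \<in> V \<Longrightarrow> f (x + y) = f x + f y" "\<And>c x. x \<in> V \<Longrightarrow> f (c *\<^sub>C x) = c *\<^sub>C f x"
    using assms unfolding clinear_on_def by auto
  show "f 0 = 0"
    using *(2)[of 0 0] csubspace_zero[OF assms(2)] by simp
  show m: "f (- x) = - f x" if "x \<in> V" for x
    using *(2)[OF that, of "-1"] by simp
  show "f (x - y) = f x - f y" if "x \<in> V" "y \<in> V" for x y
    using *(1)[OF that(1) csubspace_uminus[OF assms(2) that(2)]] m[OF that(2)] by simp
qed

lemma clinear_on_inv_into:
  assumes V: "csubspace V" and f: "clinear_on V f" "inj_on f V"
  shows "clinear_on (f ` V) (inv_into V f)"
  unfolding clinear_on_def
proof (intro conjI ballI allI)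
  note lin = clinear_on_mem[OF f(1) V]
  fix u c assume "u \<in> f ` V"
  then obtain x where x: "x \<in> V" "u = f x" by blast
  then have "inv_into V f (c *\<^sub>C u) = inv_into V f (f (c *\<^sub>C x))" by (simp add: lin)
  then show "inv_into V f (c *\<^sub>C u) = c *\<^sub>C inv_into V f u"
    using x by (simp add: inv_into_f_f[OF f(2)] csubspace_scale[OF V])
  fix v assume "v \<in> f ` V"
  then obtain y where y: "y \<in> V" "v = f y" by blast
  with x have "inv_into V f (u + v) = inv_into V f (f (x + y))" by (simp add: lin)
  then show "inv_into V f (u + v) = inv_into V f u + inv_into V f v"
    using x y by (simp add: inv_into_f_f[OF f(2)] csubspace_add[OF V])
qed

section \<open>Inner product geometry and orthogonal projection\<close>

locale ip_space =
  fixes V :: "'a::cvec set" and ip :: "'a \<Rightarrow> 'a \<Rightarrow> complex"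
  assumes ip_space: "inner_prod_on V ip"
begin

abbreviation nrm :: "'a \<Rightarrow> real" where "nrm \<equiv> ipnorm ip"

lemma subspace: "csubspace V"
  using ip_space by (simp add: inner_prod_on_def)

lemmas mem [simp, intro] = csubspace_mem[OF subspace]

lemma ip_add_left [simp]: "x \<in> V \<Longrightarrow> y \<in> V \<Longrightarrow> z \<in> V \<Longrightarrow> ip (x + y) z = ip x z + ip y z"
  and ip_scale_left [simp]: "x \<in> V \<Longrightarrow> y \<in> V \<Longrightarrow> ip (c *\<^sub>C x) y = c * ip x y"
  and ip_cnj: "x \<in> V \<Longrightarrow> y \<in> V \<Longrightarrow> ip y x = cnj (ip x y)"
  and ip_nonneg: "x \<in> V \<Longrightarrow> 0 \<le> Re (ip x x)"
  and ip_eq_zeroD: "x \<in> V \<Longrightarrow> ip x x = 0 \<Longrightarrow> x = 0"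
  using ip_space unfolding inner_prod_on_def by blast+

lemma ip_add_right [simp]: "x \<in> V \<Longrightarrow> y \<in> V \<Longrightarrow> z \<in> V \<Longrightarrow> ip z (x + y) = ip z x + ip z y"
  by (subst (1 2 3) ip_cnj) auto

lemma ip_scale_right [simp]: "x \<in> V \<Longrightarrow> y \<in> V \<Longrightarrow> ip y (c *\<^sub>C x) = cnj c * ip y x"
  by (subst (1 2) ip_cnj) auto

lemma ip_uminus_left [simp]: "x \<in> V \<Longrightarrow> y \<in> V \<Longrightarrow> ip (- x) y = - ip x y"
  using ip_scale_left[of x y "-1"] by simp

lemma ip_uminus_right [simp]: "x \<in> V \<Longrightarrow> y \<in> V \<Longrightarrow> ip y (- x) = - ip y x"
  using ip_scale_right[of x y "-1"] by simp

lemma ip_diff_left [simp]: "x \<in> V \<Longrightarrow> y \<in> V \<Longrightarrow> z \<in> V \<Longrightarrow> ip (x - y) z = ip x z - ip y z"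
  using ip_add_left[of x "- y" z] by simp

lemma ip_diff_right [simp]: "x \<in> V \<Longrightarrow> y \<in> V \<Longrightarrow> z \<in> V \<Longrightarrow> ip z (x - y) = ip z x - ip z y"
  using ip_add_right[of x "- y" z] by simp

lemma ip_zero_left [simp]: "y \<in> V \<Longrightarrow> ip 0 y = 0"
  using ip_scale_left[of 0 y 0] by simp

lemma ip_zero_right [simp]: "y \<in> V \<Longrightarrow> ip y 0 = 0"
  using ip_scale_right[of 0 y 0] by simp

lemma nrm_nonneg [simp]: "x \<in> V \<Longrightarrow> 0 \<le> nrm x"
  by (simp add: ipnorm_def ip_nonneg)

lemma nrm_sq: "x \<in> V \<Longrightarrow> (nrm x)\<^sup>2 = Re (ip x x)"
  by (simp add: ipnorm_def ip_nonneg)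

lemma ip_self: "x \<in> V \<Longrightarrow> ip x x = of_real ((nrm x)\<^sup>2)"
  using ip_cnj[of x x] by (simp add: nrm_sq complex_eq_iff)

lemma nrm_zero [simp]: "nrm 0 = 0"
  using ip_zero_left[of 0] by (simp add: ipnorm_def)

lemma nrm_eq_zeroD: "x \<in> V \<Longrightarrow> nrm x = 0 \<Longrightarrow> x = 0"
  by (rule ip_eq_zeroD) (simp_all add: ip_self)

lemma nrm_pos: "x \<in> V \<Longrightarrow> x \<noteq> 0 \<Longrightarrow> 0 < nrm x"
  using nrm_nonneg[of x] nrm_eq_zeroD[of x] by linarith

lemma nrm_scale [simp]: "x \<in> V \<Longrightarrow> nrm (c *\<^sub>C x) = cmod c * nrm x"
proof -
  assume x: "x \<in> V"
  have "(nrm (c *\<^sub>C x))\<^sup>2 = (cmod c * nrm x)\<^sup>2"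
    using x by (simp add: nrm_sq power_mult_distrib cmod_power2)
      (simp add: power2_eq_square algebra_simps)
  then show ?thesis using x by (simp add: power2_eq_iff_nonneg)
qed

lemma nrm_uminus [simp]: "x \<in> V \<Longrightarrow> nrm (- x) = nrm x"
  using nrm_scale[of x "-1"] by simp

lemma nrm_minus_commute: "x \<in> V \<Longrightarrow> y \<in> V \<Longrightarrow> nrm (x - y) = nrm (y - x)"
  using nrm_uminus[of "x - y"] by simp

lemma nrm_add_sq: "x \<in> V \<Longrightarrow> y \<in> V \<Longrightarrow> (nrm (x + y))\<^sup>2 = (nrm x)\<^sup>2 + (nrm y)\<^sup>2 + 2 * Re (ip x y)"
  using ip_cnj[of x y] by (simp add: nrm_sq)

lemma nrm_diff_sq: "x \<in> V \<Longrightarrow> y \<in> V \<Longrightarrow> (nrm (x - y))\<^sup>2 = (nrm x)\<^sup>2 + (nrm y)\<^sup>2 - 2 * Re (ip x y)"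
  using ip_cnj[of x y] by (simp add: nrm_sq)

text \<open>The coefficient is that of the orthogonal projection of \<open>x\<close> onto the line
  through \<open>y\<close>. The exact value serves twice: its nonnegativity is Cauchy-Schwarz, and
  in \<open>projection\<close> it shows that a point at minimal distance leaves an orthogonal
  residual.\<close>

lemma nrm_diff_best:
  assumes "x \<in> V" "y \<in> V" "y \<noteq> 0"
  shows "(nrm (x - (ip x y / of_real ((nrm y)\<^sup>2)) *\<^sub>C y))\<^sup>2 = (nrm x)\<^sup>2 - (cmod (ip x y))\<^sup>2 / (nrm y)\<^sup>2"
proof -
  have p: "nrm y > 0" using assms nrm_pos by auto
  define t where "t = ip x y / of_real ((nrm y)\<^sup>2)"
  have "Re (cnj t * ip x y) = (cmod (ip x y))\<^sup>2 / (nrm y)\<^sup>2"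
    unfolding t_def complex_cnj_divide complex_cnj_complex_of_real times_divide_eq_left
    by (simp add: cmod_power2 mult.commute[of "cnj _"] complex_mult_cnj del: of_real_power flip: of_real_divide)
  moreover have "(cmod t * nrm y)\<^sup>2 = (cmod (ip x y))\<^sup>2 / (nrm y)\<^sup>2"
    using p by (simp add: t_def norm_divide norm_power power_mult_distrib power_divide)
      (simp add: field_simps power2_eq_square power4_eq_xxxx)
  moreover have "(nrm (x - t *\<^sub>C y))\<^sup>2 = (nrm x)\<^sup>2 + (cmod t * nrm y)\<^sup>2 - 2 * Re (cnj t * ip x y)"
    using assms nrm_diff_sq[of x "t *\<^sub>C y"] by simp
  ultimately have "(nrm (x - t *\<^sub>C y))\<^sup>2 = (nrm x)\<^sup>2 - (cmod (ip x y))\<^sup>2 / (nrm y)\<^sup>2" by simp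
  then show ?thesis by (simp only: t_def)
qed

lemma Cauchy_Schwarz:
  assumes "x \<in> V" "y \<in> V"
  shows "cmod (ip x y) \<le> nrm x * nrm y"
proof (cases "y = 0")
  case False
  have p: "nrm y > 0" using assms nrm_pos False by auto
  have "0 \<le> (nrm x)\<^sup>2 - (cmod (ip x y))\<^sup>2 / (nrm y)\<^sup>2"
    unfolding nrm_diff_best[OF assms False, symmetric] by simp
  then have "(cmod (ip x y))\<^sup>2 \<le> (nrm x * nrm y)\<^sup>2"
    using p by (simp add: field_simps)
  then show ?thesis using assms by (auto intro: power2_le_imp_le)
qed (use assms in simp)

lemma nrm_triangle:
  assumes "x \<in> V" "y \<in> V"
  shows "nrm (x + y) \<le> nrm x + nrm y"
proof -
  have "Re (ip x y) \<le> nrm x * nrm y"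
    using Cauchy_Schwarz[OF assms] complex_Re_le_cmod[of "ip x y"] by linarith
  then have "(nrm (x + y))\<^sup>2 \<le> (nrm x + nrm y)\<^sup>2"
    using assms by (simp add: nrm_add_sq power2_sum)
  then show ?thesis using assms by (auto intro: power2_le_imp_le)
qed

lemma nrm_triangle_diff:
  assumes "x \<in> V" "y \<in> V" "z \<in> V"
  shows "nrm (x - z) \<le> nrm (x - y) + nrm (y - z)"
  using nrm_triangle[of "x - y" "y - z"] assms by simp

lemma nrm_le_add_diff:
  assumes "x \<in> V" "y \<in> V"
  shows "nrm x \<le> nrm y + nrm (x - y)"
  using nrm_triangle[of y "x - y"] assms by simp

lemma parallelogram:
  assumes "x \<in> V" "y \<in> V"
  shows "(nrm (x + y))\<^sup>2 + (nrm (x - y))\<^sup>2 = 2 * (nrm x)\<^sup>2 + 2 * (nrm y)\<^sup>2"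
  using assms by (simp add: nrm_add_sq nrm_diff_sq)

lemma ip_space_subspace:
  assumes "csubspace D" "D \<subseteq> V"
  shows "inner_prod_on D ip"
  using assms ip_space unfolding inner_prod_on_def by - (intro conjI; blast)

lemma ip_conv_nrm_diff:
  assumes "\<And>n. s n \<in> V" "l \<in> V" "x \<in> V" "ip_conv ip s l"
  shows "(\<lambda>n. nrm (x - s n)) \<longlonglongrightarrow> nrm (x - l)"
proof (rule metric_tendsto_imp_tendsto)
  show "(\<lambda>n. nrm (s n - l)) \<longlonglongrightarrow> 0"
    using assms by (simp add: ip_conv_def)
  have "dist (nrm (x - s n)) (nrm (x - l)) \<le> dist (nrm (s n - l)) 0" for n
    using nrm_triangle_diff[of x l "s n"] nrm_triangle_diff[of x "s n" l]
      nrm_minus_commute[of l "s n"] assms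
    by (simp add: dist_real_def)
  then show "\<forall>\<^sub>F n in sequentially. dist (nrm (x - s n)) (nrm (x - l)) \<le> dist (nrm (s n - l)) 0"
    by simp
qed

lemma ip_conv_clinear:
  fixes ip' :: "'b::cvec \<Rightarrow> 'b \<Rightarrow> complex"
  assumes V': "inner_prod_on V' ip'" and T: "clinear_on V T" "T ` V \<subseteq> V'"
    and bdd: "\<And>x. x \<in> V \<Longrightarrow> ipnorm ip' (T x) \<le> C * nrm x"
    and s: "\<And>n. s n \<in> V" and l: "l \<in> V" "ip_conv ip s l"
  shows "ip_conv ip' (\<lambda>n. T (s n)) (T l)"
proof -
  interpret B: ip_space V' ip' by unfold_locales (rule V')
  have lim: "(\<lambda>n. C * nrm (s n - l)) \<longlonglongrightarrow> 0"
    using l tendsto_mult_right_zero unfolding ip_conv_def by blast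
  have "ipnorm ip' (T (s n) - T l) \<le> C * nrm (s n - l)" for n
    using bdd[of "s n - l"] s l by (simp add: clinear_on_diff[OF T(1) subspace])
  moreover have "0 \<le> ipnorm ip' (T (s n) - T l)" for n
    using T s l by (intro B.nrm_nonneg B.mem) auto
  ultimately have "dist (ipnorm ip' (T (s n) - T l)) 0 \<le> dist (C * nrm (s n - l)) 0" for n
    by (smt (verit) dist_0_norm dist_commute real_norm_def)
  then show ?thesis
    unfolding ip_conv_def by (intro metric_tendsto_imp_tendsto[OF lim]) simp
qed

text \<open>Completeness is only needed for the subspace, so that the statement also covers ranges of
  operators that are bounded below.\<close>

lemma projection:
  assumes D: "hilbert_space D ip" "D \<subseteq> V" and x: "x \<in> V"
  obtains d where "d \<in> D" "\<And>e. e \<in> D \<Longrightarrow> ip (x - d) e = 0"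
proof -
  have sub: "csubspace D" using D by (simp add: hilbert_space_def inner_prod_on_def)
  note Dmem = csubspace_mem[OF sub]
  have DV: "d \<in> V" if "d \<in> D" for d using that D by auto
  define f where "f d = (nrm (x - d))\<^sup>2" for d
  define m where "m = (INF d\<in>D. f d)"
  have bdd: "bdd_below (f ` D)" by (auto simp: f_def intro!: bdd_belowI[where m = 0])
  have m_le: "m \<le> f d" if "d \<in> D" for d
    unfolding m_def using bdd that by (auto intro: cINF_lower)
  have "\<exists>d\<in>D. f d < m + e" if "e > 0" for e
    using cINF_less_iff[OF _ bdd, of "m + e"] that Dmem(1) by (auto simp: m_def)
  then have "\<exists>d\<in>D. f d < m + 1 / real (Suc n)" for n by simp
  then obtain s where s: "\<And>n. s n \<in> D" "\<And>n. f (s n) < m + 1 / real (Suc n)"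
    by metis
  have sV: "s n \<in> V" for n using s DV by auto
  \<comment> \<open>Parallelogram law for \<open>x - s j\<close> and \<open>x - s i\<close>: half
    their sum is \<open>x\<close> minus the midpoint, which lies in \<open>D\<close> and so has
    squared distance at least \<open>m\<close>. This makes a minimizing sequence Cauchy.\<close>
  have step: "(nrm (s i - s j))\<^sup>2 \<le> 2 / real (Suc i) + 2 / real (Suc j)" for i j
  proof -
    let ?mid = "(1/2) *\<^sub>C (s i + s j)"
    have "?mid \<in> D" using s Dmem by auto
    have "(x - s j) + (x - s i) = 2 *\<^sub>C (x - ?mid)"
    proof -
      have "2 *\<^sub>C x = x + x" using cscale_add_left[of 1 1 x] by (simp add: cscale_one)
      then show ?thesis by (simp add: cvec.scale_right_diff_distrib algebra_simps)
    qed
    then have "(nrm ((x - s j) + (x - s i)))\<^sup>2 = 4 * f ?mid"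
      using x sV by (simp add: f_def power_mult_distrib)
    moreover have "(x - s j) - (x - s i) = s i - s j" by simp
    ultimately have "4 * f ?mid + (nrm (s i - s j))\<^sup>2 = 2 * f (s j) + 2 * f (s i)"
      using parallelogram[of "x - s j" "x - s i"] x sV by (simp add: f_def)
    then show ?thesis using m_le[OF \<open>?mid \<in> D\<close>] s(2)[of i] s(2)[of j] by simp
  qed
  have "ip_cauchy ip s"
    unfolding ip_cauchy_def
  proof (intro allI impI)
    fix e :: real assume e: "e > 0"
    obtain N where N: "4 / e\<^sup>2 < real (Suc N)" using reals_Archimedean2[of "4/e\<^sup>2"]
      by (metis less_trans lessI of_nat_less_iff)
    have "nrm (s i - s j) < e" if "i \<ge> N" "j \<ge> N" for i j
    proof -
      have "2 / real (Suc i) \<le> 2 / real (Suc N)" "2 / real (Suc j) \<le> 2 / real (Suc N)"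
        using that by (auto intro!: divide_left_mono)
      then have "(nrm (s i - s j))\<^sup>2 \<le> 4 / real (Suc N)" using step[of i j] by simp
      also have "\<dots> < e\<^sup>2" using N e by (simp add: field_simps)
      finally show ?thesis using e by (auto intro: power2_less_imp_less)
    qed
    then show "\<exists>N. \<forall>m\<ge>N. \<forall>n\<ge>N. nrm (s m - s n) < e" by blast
  qed
  then obtain d where d: "d \<in> D" "ip_conv ip s d"
    using D s unfolding hilbert_space_def by blast
  have "(\<lambda>n. f (s n)) \<longlonglongrightarrow> f d"
    unfolding f_def by (intro tendsto_power ip_conv_nrm_diff sV x d DV)
  moreover have "(\<lambda>n. m + 1 / real (Suc n)) \<longlonglongrightarrow> m + 0"
    by (intro tendsto_intros LIMSEQ_Suc[OF lim_1_over_n])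
  ultimately have fd: "f d \<le> m"
    using s(2) by (intro LIMSEQ_le[of "\<lambda>n. f (s n)" "f d" "\<lambda>n. m + 1 / real (Suc n)" m]) (auto intro: less_imp_le)
  have "ip (x - d) e = 0" if e: "e \<in> D" for e
  proof (cases "e = 0")
    case False
    \<comment> \<open>Moving \<open>d\<close> by the projection of the residual onto
      \<open>e\<close> would lower the distance below \<open>m\<close> unless the inner product is
      zero.\<close>
    let ?c = "ip (x - d) e / of_real ((nrm e)\<^sup>2)"
    have "d + ?c *\<^sub>C e \<in> D" using d e Dmem by blast
    from m_le[OF this] fd have "(nrm (x - d))\<^sup>2 \<le> (nrm (x - d - ?c *\<^sub>C e))\<^sup>2"
      by (simp add: f_def diff_diff_eq)
    also have "\<dots> = (nrm (x - d))\<^sup>2 - (cmod (ip (x - d) e))\<^sup>2 / (nrm e)\<^sup>2"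
      by (rule nrm_diff_best) (use x d e DV False in auto)
    finally show ?thesis using nrm_pos[OF DV[OF e] False] by (simp add: divide_le_0_iff)
  qed (use d x DV in simp)
  with d that show ?thesis by blast
qed

end

section \<open>Riesz representation and ranges of operators bounded below\<close>

locale hilbert =
  fixes V :: "'a::cvec set" and ip :: "'a \<Rightarrow> 'a \<Rightarrow> complex"
  assumes hilbert: "hilbert_space V ip"

sublocale hilbert \<subseteq> ip_space
  using hilbert by unfold_locales (simp add: hilbert_space_def)

context hilbert
begin

lemma cauchy_conv:
  assumes "\<And>n. s n \<in> V" "ip_cauchy ip s"
  obtains l where "l \<in> V" "ip_conv ip s l"
  using hilbert assms unfolding hilbert_space_def by blast

text \<open>Representing vector: a suitable multiple of a vector orthogonal to the kernel.\<close>

lemma riesz: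
  fixes \<phi> :: "'a \<Rightarrow> complex"
  assumes add: "\<And>x y. x \<in> V \<Longrightarrow> y \<in> V \<Longrightarrow> \<phi> (x + y) = \<phi> x + \<phi> y"
    and scale: "\<And>c x. x \<in> V \<Longrightarrow> \<phi> (c *\<^sub>C x) = c * \<phi> x"
    and bdd: "\<And>x. x \<in> V \<Longrightarrow> cmod (\<phi> x) \<le> C * nrm x"
  obtains u where "u \<in> V" "\<And>x. x \<in> V \<Longrightarrow> \<phi> x = ip x u"
proof -
  define N where "N = {x \<in> V. \<phi> x = 0}"
  have diff: "\<phi> (x - y) = \<phi> x - \<phi> y" if "x \<in> V" "y \<in> V" for x y
    using add[of x "- y"] scale[of y "-1"] that by simp
  have sub: "csubspace N"
    using scale[of 0 0] by (auto simp: N_def csubspace_def add scale)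
  have "hilbert_space N ip"
    unfolding hilbert_space_def
  proof (intro conjI allI impI)
    show "inner_prod_on N ip" by (rule ip_space_subspace[OF sub]) (auto simp: N_def)
    fix s assume s: "(\<forall>n. s n \<in> N) \<and> ip_cauchy ip s"
    then have sV: "s n \<in> V" "\<phi> (s n) = 0" for n by (auto simp: N_def)
    obtain l where l: "l \<in> V" "ip_conv ip s l" using cauchy_conv s sV by metis
    have "cmod (\<phi> l) \<le> C * nrm (s n - l)" for n
      using bdd[of "s n - l"] diff[of "s n" l] sV l by simp
    moreover have "(\<lambda>n. C * nrm (s n - l)) \<longlonglongrightarrow> C * 0"
      using l unfolding ip_conv_def by (intro tendsto_intros)
    ultimately have "cmod (\<phi> l) \<le> 0"
      by (intro LIMSEQ_le_const[of "\<lambda>n. C * nrm (s n - l)"]) auto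
    with l show "\<exists>l\<in>N. ip_conv ip s l" by (auto simp: N_def)
  qed
  note proj = projection[OF this]
  show ?thesis
  proof (cases "N = V")
    case True
    then show ?thesis using that[of 0] by (auto simp: N_def)
  next
    case False
    then obtain x0 where x0: "x0 \<in> V" "\<phi> x0 \<noteq> 0" by (auto simp: N_def)
    obtain d where d: "d \<in> N" "\<And>e. e \<in> N \<Longrightarrow> ip (x0 - d) e = 0"
      using proj[of x0] x0 by (auto simp: N_def)
    define w where "w = x0 - d"
    have w: "w \<in> V" "\<phi> w \<noteq> 0" using x0 d by (auto simp: w_def N_def diff)
    have "w \<noteq> 0" using w scale[of 0 0] by auto
    then have pos: "nrm w > 0" using w nrm_pos by auto
    define u where "u = (cnj (\<phi> w) / of_real ((nrm w)\<^sup>2)) *\<^sub>C w"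
    have "\<phi> x = ip x u" if x: "x \<in> V" for x
    proof -
      have "x - (\<phi> x / \<phi> w) *\<^sub>C w \<in> N" using x w by (simp add: N_def diff scale)
      then have "ip w (x - (\<phi> x / \<phi> w) *\<^sub>C w) = 0" using d(2) by (simp add: w_def)
      then have "ip (x - (\<phi> x / \<phi> w) *\<^sub>C w) w = 0"
        using ip_cnj[of w "x - (\<phi> x / \<phi> w) *\<^sub>C w"] w x by simp
      then have "ip x w = \<phi> x / \<phi> w * of_real ((nrm w)\<^sup>2)"
        using x w by (simp add: ip_self)
      then show ?thesis using x w pos by (simp add: u_def)
    qed
    moreover have "u \<in> V" using w by (simp add: u_def)
    ultimately show ?thesis using that by blast
  qed
qed

text \<open>The lower bound turns a Cauchy sequence in the range into a Cauchy sequence of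
  preimages; the upper bound carries its limit back to the range.\<close>

lemma range_hilbert:
  fixes ip' :: "'b::cvec \<Rightarrow> 'b \<Rightarrow> complex"
  assumes V': "inner_prod_on V' ip'" and T: "clinear_on V T" "T ` V \<subseteq> V'"
    and below: "\<And>x. x \<in> V \<Longrightarrow> nrm x \<le> c * ipnorm ip' (T x)"
    and above: "\<And>x. x \<in> V \<Longrightarrow> ipnorm ip' (T x) \<le> C * nrm x"
  shows "hilbert_space (T ` V) ip'"
proof -
  interpret B: ip_space V' ip' by unfold_locales (rule V')
  note lin = clinear_on_mem[OF T(1) subspace]
  show ?thesis unfolding hilbert_space_def
  proof (intro conjI allI impI)
    have "csubspace (T ` V)"
      unfolding csubspace_def
      using lin(3) by (auto simp: lin(1,2)[symmetric] intro!: imageI image_eqI[of 0 T 0])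
    then show "inner_prod_on (T ` V) ip'" by (rule B.ip_space_subspace) (rule T)
    fix t assume t: "(\<forall>n. t n \<in> T ` V) \<and> ip_cauchy ip' t"
    then have "\<forall>n. \<exists>x. x \<in> V \<and> t n = T x" by blast
    then obtain s where s: "\<And>n. s n \<in> V" "\<And>n. t n = T (s n)" by metis
    \<comment> \<open>No sign is imposed on \<open>c\<close>, hence the absolute value; the
      \<open>+ 1\<close> in the denominators below covers the case \<open>c = 0\<close>.\<close>
    have le: "nrm (s m - s n) \<le> \<bar>c\<bar> * ipnorm ip' (t m - t n)" for m n
    proof -
      have "nrm (s m - s n) \<le> c * ipnorm ip' (t m - t n)"
        using below[of "s m - s n"] s lin by simp
      also have "\<dots> \<le> \<bar>c\<bar> * ipnorm ip' (t m - t n)"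
        using t T by (intro mult_right_mono B.nrm_nonneg B.mem) auto
      finally show ?thesis .
    qed
    have "ip_cauchy ip s"
      unfolding ip_cauchy_def
    proof (intro allI impI)
      fix e :: real assume e: "e > 0"
      then have "e / (\<bar>c\<bar> + 1) > 0" by simp
      then obtain N where N: "\<forall>m\<ge>N. \<forall>n\<ge>N. ipnorm ip' (t m - t n) < e / (\<bar>c\<bar> + 1)"
        using t unfolding ip_cauchy_def by blast
      have "nrm (s m - s n) < e" if "m \<ge> N" "n \<ge> N" for m n
      proof -
        have "nrm (s m - s n) \<le> \<bar>c\<bar> * (e / (\<bar>c\<bar> + 1))"
          using le[of m n] N that by (meson abs_ge_zero less_imp_le mult_left_mono order_trans)
        also have "\<dots> < e" using e by (simp add: field_simps)
        finally show ?thesis .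
      qed
      then show "\<exists>N. \<forall>m\<ge>N. \<forall>n\<ge>N. nrm (s m - s n) < e" by blast
    qed
    then obtain l where l: "l \<in> V" "ip_conv ip s l" using cauchy_conv s by metis
    have "ip_conv ip' (\<lambda>n. T (s n)) (T l)"
      by (rule ip_conv_clinear[where C = C, OF V' T above s(1) l])
    moreover have "t = (\<lambda>n. T (s n))" using s(2) by blast
    ultimately have "ip_conv ip' t (T l)" by simp
    then show "\<exists>l\<in>T ` V. ip_conv ip' t l" using l by blast
  qed
qed

text \<open>The range is complete, so every \<open>y\<close> has a projection onto it; the residual
  is orthogonal to the range and vanishes by \<open>perp\<close>. This yields surjectivity of both
  \<open>S\<close> and \<open>V#\<close>.\<close>

lemma bounded_below_surj:
  fixes ip' :: "'b::cvec \<Rightarrow> 'b \<Rightarrow> complex"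
  assumes V': "inner_prod_on V' ip'" and T: "clinear_on V T" "T ` V \<subseteq> V'"
    and below: "\<And>x. x \<in> V \<Longrightarrow> nrm x \<le> c * ipnorm ip' (T x)"
    and above: "\<And>x. x \<in> V \<Longrightarrow> ipnorm ip' (T x) \<le> C * nrm x"
    and perp: "\<And>y. y \<in> V' \<Longrightarrow> (\<And>x. x \<in> V \<Longrightarrow> ip' y (T x) = 0) \<Longrightarrow> y = 0"
  shows "T ` V = V'"
proof
  show "V' \<subseteq> T ` V"
  proof
    fix y assume y: "y \<in> V'"
    interpret B: ip_space V' ip' by unfold_locales (rule V')
    obtain d where d: "d \<in> T ` V" "\<And>e. e \<in> T ` V \<Longrightarrow> ip' (y - d) e = 0"
      using B.projection[OF range_hilbert[OF V' T below above] T(2) y] by blast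
    then have "y - d = 0" using y T(2) by (intro perp) auto
    then show "y \<in> T ` V" using d by simp
  qed
qed (rule T)

end

section \<open>Dissipative relations and contractions\<close>

lemma half_add_half [simp]: "(1/2) *\<^sub>C z + (1/2) *\<^sub>C z = (z::'a::cvec)"
  by (simp flip: cscale_add_left)

lemma fst_cscale [simp]: "fst (c *\<^sub>C p) = c *\<^sub>C fst p"
  and snd_cscale [simp]: "snd (c *\<^sub>C p) = c *\<^sub>C snd p"
  and cscale_Pair: "c *\<^sub>C (a, b) = (c *\<^sub>C a, c *\<^sub>C b)"
  by (simp_all add: cscale_prod_def)

section \<open>Limits, the product space and dissipativity in terms of norms\<close>

context ip_space
begin

lemma ip_conv_add:
  assumes "\<And>n. s n \<in> V" "\<And>n. t n \<in> V" "l \<in> V" "k \<in> V" "ip_conv ip s l" "ip_conv ip t k"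
  shows "ip_conv ip (\<lambda>n. s n + t n) (l + k)"
proof -
  have "(\<lambda>n. nrm (s n - l) + nrm (t n - k)) \<longlonglongrightarrow> 0 + 0"
    using assms unfolding ip_conv_def by (intro tendsto_add)
  then have lim: "(\<lambda>n. nrm (s n - l) + nrm (t n - k)) \<longlonglongrightarrow> 0" by simp
  have "dist (nrm (s n + t n - (l + k))) 0 \<le> dist (nrm (s n - l) + nrm (t n - k)) 0" for n
    using nrm_triangle[of "s n - l" "t n - k"] assms by (simp add: add_diff_add)
  then show ?thesis
    unfolding ip_conv_def by (intro metric_tendsto_imp_tendsto[OF lim]) simp
qed

lemma ip_conv_scale:
  assumes "\<And>n. s n \<in> V" "l \<in> V" "ip_conv ip s l"
  shows "ip_conv ip (\<lambda>n. c *\<^sub>C s n) (c *\<^sub>C l)"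
  using assms tendsto_mult_right_zero[of "\<lambda>n. nrm (s n - l)" sequentially "cmod c"]
  by (simp add: ip_conv_def flip: cvec.scale_right_diff_distrib)

lemma ip_conv_const: "ip_conv ip (\<lambda>_. l) l"
  by (simp add: ip_conv_def)

lemma ip_conv_nrm:
  assumes "\<And>n. s n \<in> V" "l \<in> V" "ip_conv ip s l"
  shows "(\<lambda>n. nrm (s n)) \<longlonglongrightarrow> nrm l"
  using ip_conv_nrm_diff[of s l 0] assms by simp

definition seq_closure :: "'a set \<Rightarrow> 'a set" where
  "seq_closure R = {l \<in> V. \<exists>s. (\<forall>n. s n \<in> R) \<and> ip_conv ip s l}"

lemma subset_seq_closure: "R \<subseteq> V \<Longrightarrow> R \<subseteq> seq_closure R"
  unfolding seq_closure_def
proof (intro subsetI CollectI conjI)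
  fix x assume "R \<subseteq> V" "x \<in> R"
  then show "x \<in> V" "\<exists>s. (\<forall>n. s n \<in> R) \<and> ip_conv ip s x"
    using ip_conv_const by (auto intro!: exI[of _ "\<lambda>_. x"])
qed

lemma csubspace_seq_closure:
  assumes R: "csubspace R" "R \<subseteq> V"
  shows "csubspace (seq_closure R)"
  unfolding csubspace_def
proof (intro conjI ballI allI)
  show "0 \<in> seq_closure R"
    using subset_seq_closure[OF R(2)] csubspace_zero[OF R(1)] by blast
  fix x c assume "x \<in> seq_closure R"
  then obtain s where x: "x \<in> V" "\<And>n. s n \<in> R" "ip_conv ip s x" by (auto simp: seq_closure_def)
  then have "ip_conv ip (\<lambda>n. c *\<^sub>C s n) (c *\<^sub>C x)" using R by (intro ip_conv_scale) auto
  moreover have "\<forall>n. c *\<^sub>C s n \<in> R" using x R csubspace_scale by blast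
  ultimately show "c *\<^sub>C x \<in> seq_closure R"
    using x(1) by (auto simp: seq_closure_def)
  fix y assume "y \<in> seq_closure R"
  then obtain t where y: "y \<in> V" "\<And>n. t n \<in> R" "ip_conv ip t y" by (auto simp: seq_closure_def)
  then have "ip_conv ip (\<lambda>n. s n + t n) (x + y)" using R x by (intro ip_conv_add) auto
  moreover have "\<forall>n. s n + t n \<in> R" using x y R csubspace_add by blast
  ultimately show "x + y \<in> seq_closure R"
    using x(1) y(1) by (auto simp: seq_closure_def)
qed

lemma inner_prod_on_ip2: "inner_prod_on (V \<times> V) (ip2 ip)"
proof -
  have def: "u = 0" if "u \<in> V \<times> V" "ip2 ip u u = 0" for u
  proof -
    have "(nrm (fst u))\<^sup>2 + (nrm (snd u))\<^sup>2 = 0"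
      using that by (simp add: ip2_def nrm_sq mem_Times_iff flip: plus_complex.simps)
    then have "nrm (fst u) = 0" "nrm (snd u) = 0" by (auto simp: add_nonneg_eq_0_iff)
    with that show ?thesis using nrm_eq_zeroD by (auto simp: prod_eq_iff mem_Times_iff)
  qed
  have sub: "csubspace (V \<times> V)"
    by (auto simp: csubspace_def cscale_prod_def zero_prod_def)
  have sym: "ip2 ip v u = cnj (ip2 ip u v)" if "u \<in> V \<times> V" "v \<in> V \<times> V" for u v
    using that ip_cnj[of "fst u" "fst v"] ip_cnj[of "snd u" "snd v"] by (simp add: ip2_def mem_Times_iff)
  show ?thesis
    unfolding inner_prod_on_def
    by (intro conjI ballI allI impI;
        (rule sub | rule def sym; assumption | simp add: ip2_def mem_Times_iff algebra_simps ip_nonneg))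
qed

lemma ipnorm_ip2_sq: "u \<in> V \<times> V \<Longrightarrow> (ipnorm (ip2 ip) u)\<^sup>2 = (nrm (fst u))\<^sup>2 + (nrm (snd u))\<^sup>2"
  using ip_nonneg[of "fst u"] ip_nonneg[of "snd u"]
  by (auto simp: ipnorm_def ip2_def mem_Times_iff)

text \<open>On a pair \<open>(x, T x)\<close> this is \<open>(T + c) x\<close>. The Cayley transform
  of a relation sends \<open>cayley_map (- \<i>) u\<close> to
  \<open>cayley_map \<i> u\<close>.\<close>

definition cayley_map :: "complex \<Rightarrow> 'a \<times> 'a \<Rightarrow> 'a" where
  "cayley_map c u = snd u + c *\<^sub>C fst u"

lemma cayley_map_mem [simp]: "u \<in> V \<times> V \<Longrightarrow> cayley_map c u \<in> V"
  by (auto simp: cayley_map_def)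

lemma cayley_map_image: "R \<subseteq> V \<times> V \<Longrightarrow> cayley_map c ` R \<subseteq> V"
  using cayley_map_mem by blast

lemma clinear_cayley_map: "clinear_on R (cayley_map c)"
  by (auto simp: clinear_on_def cayley_map_def cscale_add_right cscale_cscale mult.commute add_ac)

lemma cayley_map_add: "cayley_map c (u + v) = cayley_map c u + cayley_map c v"
  and cayley_map_scale: "cayley_map c (d *\<^sub>C u) = d *\<^sub>C cayley_map c u"
  by (simp_all add: clinear_on_add[OF clinear_cayley_map csubspace_UNIV]
      clinear_on_scale[OF clinear_cayley_map csubspace_UNIV])

lemma nrm_cayley_map_sq:
  assumes "(x, y) \<in> V \<times> V"
  shows nrm_cayley_ii: "(nrm (cayley_map \<i> (x, y)))\<^sup>2 = (nrm x)\<^sup>2 + (nrm y)\<^sup>2 + 2 * Im (ip y x)"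
    and nrm_cayley_minus_ii: "(nrm (cayley_map (- \<i>) (x, y)))\<^sup>2 = (nrm x)\<^sup>2 + (nrm y)\<^sup>2 - 2 * Im (ip y x)"
  using assms by (simp_all add: cayley_map_def nrm_add_sq nrm_diff_sq)

text \<open>The two squared norms differ by \<open>4 * Im (ip y x)\<close>, so dissipativity is the
  same as contractivity of the Cayley transform.\<close>

lemma nrm_cayley_map_le_iff:
  assumes "(x, y) \<in> V \<times> V"
  shows "nrm (cayley_map \<i> (x, y)) \<le> nrm (cayley_map (- \<i>) (x, y)) \<longleftrightarrow> Im (ip y x) \<le> 0"
  using abs_le_square_iff[of "nrm (cayley_map \<i> (x, y))" "nrm (cayley_map (- \<i>) (x, y))"]
  unfolding nrm_cayley_map_sq[OF assms] abs_of_nonneg[OF nrm_nonneg[OF cayley_map_mem[OF assms]]]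
  by auto

definition dissipative_rel :: "('a \<times> 'a) set \<Rightarrow> bool" where
  "dissipative_rel R \<longleftrightarrow> csubspace R \<and> R \<subseteq> V \<times> V \<and> (\<forall>(x, y)\<in>R. Im (ip y x) \<le> 0)"

definition max_dissipative_rel :: "('a \<times> 'a) set \<Rightarrow> bool" where
  "max_dissipative_rel R \<longleftrightarrow> dissipative_rel R \<and> (\<forall>R'. dissipative_rel R' \<and> R \<subseteq> R' \<longrightarrow> R' = R)"

lemma dissipative_rel_iff:
  "dissipative_rel R \<longleftrightarrow> csubspace R \<and> R \<subseteq> V \<times> V \<and>
     (\<forall>u\<in>R. nrm (cayley_map \<i> u) \<le> nrm (cayley_map (- \<i>) u))"
proof -
  have "(case u of (x, y) \<Rightarrow> Im (ip y x) \<le> 0) \<longleftrightarrow> nrm (cayley_map \<i> u) \<le> nrm (cayley_map (- \<i>) u)"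
    if "u \<in> V \<times> V" for u
    using that nrm_cayley_map_le_iff by (cases u) blast
  then show ?thesis unfolding dissipative_rel_def by blast
qed

text \<open>A pair of a larger dissipative relation has a partner in \<open>R\<close> with the same
  value of \<open>y - l x\<close>. Their difference has the form \<open>(v, l v)\<close>, for which
  the form has imaginary part \<open>Im l\<close> times the squared norm of \<open>v\<close>;
  dissipativity forces \<open>v = 0\<close>.\<close>

lemma dissipative_range_imp_max:
  assumes R: "dissipative_rel R" and l: "Im l > 0"
    and ran: "\<And>z. z \<in> V \<Longrightarrow> \<exists>x y. (x, y) \<in> R \<and> y - l *\<^sub>C x = z"
  shows "max_dissipative_rel R"
  unfolding max_dissipative_rel_def
proof (intro conjI allI impI R)
  fix R' assume R': "dissipative_rel R' \<and> R \<subseteq> R'"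
  have "(x', y') \<in> R" if xy': "(x', y') \<in> R'" for x' y'
  proof -
    have V': "x' \<in> V" "y' \<in> V" using R' xy' by (auto simp: dissipative_rel_def)
    then obtain x y where xy: "(x, y) \<in> R" "y - l *\<^sub>C x = y' - l *\<^sub>C x'"
      using ran[of "y' - l *\<^sub>C x'"] by auto
    have V: "x \<in> V" "y \<in> V" using R xy by (auto simp: dissipative_rel_def)
    have diff: "y' - y = l *\<^sub>C (x' - x)"
      using xy(2) by (simp add: cvec.scale_right_diff_distrib algebra_simps)
    have "(x', y') - (x, y) \<in> R'"
      using R' xy xy' by (intro csubspace_diff) (auto simp: dissipative_rel_def)
    then have "Im (ip (y' - y) (x' - x)) \<le> 0"
      using R' by (auto simp: dissipative_rel_def)
    then have "Im l * (nrm (x' - x))\<^sup>2 \<le> 0"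
      using V V' by (simp add: diff ip_self del: ip_diff_left ip_diff_right of_real_power)
    then have "nrm (x' - x) = 0" using l by (simp add: mult_le_0_iff)
    then have "x' - x = 0" using V V' by (intro nrm_eq_zeroD) auto
    with diff xy show ?thesis by simp
  qed
  with R' show "R' = R" by auto
qed

end

context hilbert
begin

lemma hilbert_ip2: "hilbert_space (V \<times> V) (ip2 ip)"
  unfolding hilbert_space_def
proof (intro conjI allI impI inner_prod_on_ip2)
  interpret P: ip_space "V \<times> V" "ip2 ip" by unfold_locales (rule inner_prod_on_ip2)
  have le: "nrm (fst u) \<le> ipnorm (ip2 ip) u" "nrm (snd u) \<le> ipnorm (ip2 ip) u"
    "ipnorm (ip2 ip) u \<le> nrm (fst u) + nrm (snd u)" if "u \<in> V \<times> V" for u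
  proof -
    have [simp]: "fst u \<in> V" "snd u \<in> V" using that by auto
    show "nrm (fst u) \<le> ipnorm (ip2 ip) u" "nrm (snd u) \<le> ipnorm (ip2 ip) u"
      by (rule power2_le_imp_le; use that ipnorm_ip2_sq[OF that] in simp)+
    show "ipnorm (ip2 ip) u \<le> nrm (fst u) + nrm (snd u)"
      by (rule power2_le_imp_le) (use that ipnorm_ip2_sq[OF that] in \<open>simp_all add: power2_sum\<close>)
  qed
  fix s assume s: "(\<forall>n. s n \<in> V \<times> V) \<and> ip_cauchy (ip2 ip) s"
  then have mem: "s n \<in> V \<times> V" "fst (s n) \<in> V" "snd (s n) \<in> V" for n
    by (auto simp: mem_Times_iff)
  have d: "s m - s n \<in> V \<times> V" for m n using mem by (intro P.mem) auto
  have "ip_cauchy ip (\<lambda>n. fst (s n))" "ip_cauchy ip (\<lambda>n. snd (s n))"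
    using s le[OF d] unfolding ip_cauchy_def fst_diff[symmetric] snd_diff[symmetric]
    by (meson order_le_less_trans)+
  then obtain a b where ab: "a \<in> V" "ip_conv ip (\<lambda>n. fst (s n)) a" "b \<in> V" "ip_conv ip (\<lambda>n. snd (s n)) b"
    using mem cauchy_conv by metis
  have "(\<lambda>n. nrm (fst (s n) - a) + nrm (snd (s n) - b)) \<longlonglongrightarrow> 0 + 0"
    using ab unfolding ip_conv_def by (intro tendsto_add)
  then have lim: "(\<lambda>n. nrm (fst (s n) - a) + nrm (snd (s n) - b)) \<longlonglongrightarrow> 0" by simp
  have "s n - (a, b) \<in> V \<times> V" for n using mem ab by (intro P.mem) auto
  then have "dist (ipnorm (ip2 ip) (s n - (a, b))) 0 \<le> dist (nrm (fst (s n) - a) + nrm (snd (s n) - b)) 0" for n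
    using le(3)[of "s n - (a, b)"] mem ab by (simp add: P.nrm_nonneg)
  then have "ip_conv (ip2 ip) s (a, b)"
    unfolding ip_conv_def by (intro metric_tendsto_imp_tendsto[OF lim]) simp
  with ab show "\<exists>l\<in>V \<times> V. ip_conv (ip2 ip) s l" by blast
qed

text \<open>If some \<open>w \<noteq> 0\<close> were orthogonal to the (closed) range of \<open>R - \<i>\<close>, the Cayley transform of
  \<open>R\<close> could be extended by \<open>w \<mapsto> 0\<close>.\<close>

lemma max_dissipative_imp_range:
  assumes R: "max_dissipative_rel R" and z: "z \<in> V"
  shows "\<exists>u\<in>R. cayley_map (- \<i>) u = z"
proof -
  interpret P: hilbert "V \<times> V" "ip2 ip" by unfold_locales (rule hilbert_ip2)
  have dis: "csubspace R" "R \<subseteq> V \<times> V"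
    "\<And>u. u \<in> R \<Longrightarrow> nrm (cayley_map \<i> u) \<le> nrm (cayley_map (- \<i>) u)"
    using R by (auto simp: max_dissipative_rel_def dissipative_rel_iff)
  have max: "R' = R" if "csubspace R'" "R' \<subseteq> V \<times> V" "R \<subseteq> R'"
    "\<And>u. u \<in> R' \<Longrightarrow> nrm (cayley_map \<i> u) \<le> nrm (cayley_map (- \<i>) u)" for R'
    using R that by (auto simp: max_dissipative_rel_def dissipative_rel_iff)
  have bdd: "nrm (cayley_map c u) \<le> 2 * ipnorm (ip2 ip) u" if "u \<in> V \<times> V" "cmod c = 1" for u c
  proof (rule power2_le_imp_le)
    have [simp]: "fst u \<in> V" "snd u \<in> V" using that by auto
    have "nrm (cayley_map c u) \<le> nrm (snd u) + nrm (fst u)"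
      unfolding cayley_map_def using nrm_triangle[of "snd u" "c *\<^sub>C fst u"] that by simp
    then have "(nrm (cayley_map c u))\<^sup>2 \<le> (nrm (snd u) + nrm (fst u))\<^sup>2"
      using that by (intro power_mono) auto
    also have "\<dots> \<le> 2 * ((nrm (fst u))\<^sup>2 + (nrm (snd u))\<^sup>2)"
      using sum_squares_ge_zero[of "nrm (snd u) - nrm (fst u)" 0]
      by (simp add: power2_eq_square algebra_simps)
    also have "\<dots> \<le> 4 * ((nrm (fst u))\<^sup>2 + (nrm (snd u))\<^sup>2)" by simp
    finally show "(nrm (cayley_map c u))\<^sup>2 \<le> (2 * ipnorm (ip2 ip) u)\<^sup>2"
      using that by (simp add: power_mult_distrib ipnorm_ip2_sq)
  qed (use that in \<open>simp add: P.nrm_nonneg\<close>)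
  \<comment> \<open>The inequality between the two norms passes to limits, so the closure is a
    dissipative extension of \<open>R\<close>; maximality makes \<open>R\<close> closed.\<close>
  have "P.seq_closure R = R"
  proof (rule max[OF P.csubspace_seq_closure[OF dis(1,2)] _ P.subset_seq_closure[OF dis(2)]])
    show "P.seq_closure R \<subseteq> V \<times> V" unfolding P.seq_closure_def by blast
    fix u assume "u \<in> P.seq_closure R"
    then obtain s where u: "u \<in> V \<times> V" "\<And>n. s n \<in> R" "ip_conv (ip2 ip) s u"
      by (auto simp: P.seq_closure_def)
    have lim: "(\<lambda>n. nrm (cayley_map c (s n))) \<longlonglongrightarrow> nrm (cayley_map c u)" if c: "cmod c = 1" for c
    proof (rule ip_conv_nrm)
      show "ip_conv ip (\<lambda>n. cayley_map c (s n)) (cayley_map c u)"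
        by (rule P.ip_conv_clinear[OF ip_space clinear_cayley_map cayley_map_image[OF order_refl] bdd _ u(1,3)])
          (use u(2) dis(2) c in blast)+
    qed (use u dis(2) in \<open>blast intro: cayley_map_mem\<close>)+
    show "nrm (cayley_map \<i> u) \<le> nrm (cayley_map (- \<i>) u)"
      using dis(3) u(2) by (intro LIMSEQ_le[OF lim lim]) auto
  qed
  then have lim_R: "l \<in> R" if "\<And>n. s n \<in> R" "l \<in> V \<times> V" "ip_conv (ip2 ip) s l" for s l
    using that unfolding P.seq_closure_def by blast
  have closed: "hilbert_space R (ip2 ip)"
    unfolding hilbert_space_def
  proof (intro conjI allI impI P.ip_space_subspace[OF dis(1,2)])
    fix s assume s: "(\<forall>n. s n \<in> R) \<and> ip_cauchy (ip2 ip) s"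
    then have "s n \<in> V \<times> V" for n using dis(2) by blast
    then obtain l where "l \<in> V \<times> V" "ip_conv (ip2 ip) s l" using P.cauchy_conv s by blast
    with s lim_R show "\<exists>l\<in>R. ip_conv (ip2 ip) s l" by blast
  qed
  interpret R: hilbert R "ip2 ip" by unfold_locales (rule closed)
  define D where "D = cayley_map (- \<i>) ` R"
  have DV: "D \<subseteq> V" unfolding D_def by (rule cayley_map_image[OF dis(2)])
  have "hilbert_space D ip"
    unfolding D_def
  proof (rule R.range_hilbert[OF ip_space clinear_cayley_map])
    fix u assume u: "u \<in> R"
    obtain x y where xy: "u = (x, y)" by force
    have xyV: "(x, y) \<in> V \<times> V" using u dis(2) xy by blast
    \<comment> \<open>Dissipativity makes the last term of \<open>nrm_cayley_minus_ii\<close>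
      nonnegative, so \<open>R - \<i>\<close> is bounded below with constant 1 on the complete space
      \<open>R\<close>, and its range \<open>D\<close> is complete.\<close>
    have "Im (ip y x) \<le> 0" using dis(3)[OF u] nrm_cayley_map_le_iff[OF xyV] xy by simp
    then have "(ipnorm (ip2 ip) u)\<^sup>2 \<le> (nrm (cayley_map (- \<i>) u))\<^sup>2"
      using nrm_cayley_minus_ii[OF xyV] ipnorm_ip2_sq[OF xyV] unfolding xy by simp
    then show "ipnorm (ip2 ip) u \<le> 1 * nrm (cayley_map (- \<i>) u)"
      using xyV by (auto intro!: power2_le_imp_le simp: xy)
    show "nrm (cayley_map (- \<i>) u) \<le> 2 * ipnorm (ip2 ip) u"
      using bdd[of u "- \<i>"] xyV by (simp add: xy)
  qed (use DV D_def in blast)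
  then obtain d where d: "d \<in> D" "\<And>e. e \<in> D \<Longrightarrow> ip (z - d) e = 0"
    using projection DV z by metis
  define w where "w = z - d"
  have w: "w \<in> V" using z d DV by (auto simp: w_def)
  \<comment> \<open>The unique solution of \<open>cayley_map (- \<i>) u0 = w\<close> and
    \<open>cayley_map \<i> u0 = 0\<close>: adjoining it extends the Cayley transform by sending
    \<open>w\<close> to 0.\<close>
  define u0 where "u0 = ((\<i>/2) *\<^sub>C w, (1/2) *\<^sub>C w)"
  have u0: "u0 \<in> V \<times> V" "cayley_map \<i> u0 = 0" "cayley_map (- \<i>) u0 = w"
    using w by (simp_all add: u0_def cayley_map_def cscale_cscale)
  define R' where "R' = {u + c *\<^sub>C u0 | u c. u \<in> R}"
  have "R' = R"
  proof (rule max)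
    show "csubspace R'"
      unfolding csubspace_def
    proof (intro conjI ballI allI)
      show "0 \<in> R'" unfolding R'_def using csubspace_zero[OF dis(1)] cvec.scale_zero_left[of u0]
        by (metis (mono_tags, lifting) add_0 mem_Collect_eq)
      fix v b assume "v \<in> R'"
      then obtain u c where v: "v = u + c *\<^sub>C u0" "u \<in> R" by (auto simp: R'_def)
      then have "b *\<^sub>C v = b *\<^sub>C u + (b * c) *\<^sub>C u0" by (simp add: cscale_add_right cscale_cscale)
      with v show "b *\<^sub>C v \<in> R'" using csubspace_scale[OF dis(1)] unfolding R'_def by blast
      fix v' assume "v' \<in> R'"
      then obtain u' c' where v': "v' = u' + c' *\<^sub>C u0" "u' \<in> R" by (auto simp: R'_def)
      with v have "v + v' = (u + u') + (c + c') *\<^sub>C u0" by (simp add: cscale_add_left add_ac)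
      with v v' show "v + v' \<in> R'" using csubspace_add[OF dis(1)] unfolding R'_def by blast
    qed
    show "R \<subseteq> R'"
    proof
      fix u assume u: "u \<in> R"
      have "u = u + 0 *\<^sub>C u0" by simp
      with u show "u \<in> R'" unfolding R'_def by blast
    qed
    show "R' \<subseteq> V \<times> V"
      unfolding R'_def using P.mem(2)[OF _ P.mem(3)[OF u0(1)]] dis(2) by blast
    fix v assume "v \<in> R'"
    then obtain u c where v: "v = u + c *\<^sub>C u0" "u \<in> R" by (auto simp: R'_def)
    let ?t = "cayley_map (- \<i>) u"
    have tV: "?t \<in> V" using v(2) dis(2) cayley_map_mem by blast
    have "ip w ?t = 0" using d(2)[of ?t] v(2) by (simp add: D_def w_def)
    with tV w have t: "?t \<in> V" "ip ?t w = 0" using ip_cnj[of w ?t] by simp_all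
    \<comment> \<open>Since \<open>w\<close> is orthogonal to the range, adding \<open>c w\<close>
      can only enlarge the right-hand norm, while the left-hand norm does not see \<open>u0\<close>
      at all.\<close>
    have "(nrm ?t)\<^sup>2 \<le> (nrm (?t + c *\<^sub>C w))\<^sup>2" using t w by (simp add: nrm_add_sq)
    then have "nrm ?t \<le> nrm (?t + c *\<^sub>C w)" using t w by (auto intro: power2_le_imp_le)
    with dis(3)[OF v(2)] show "nrm (cayley_map \<i> v) \<le> nrm (cayley_map (- \<i>) v)"
      by (simp add: v(1) cayley_map_add cayley_map_scale u0)
  qed
  moreover have "u0 = 0 + 1 *\<^sub>C u0" by (simp add: cscale_one)
  ultimately have "u0 \<in> R" unfolding R'_def using csubspace_zero[OF dis(1)] by blast
  then have "w \<in> D" using u0 by (force simp: D_def)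
  then have "ip w w = 0" using d(2) by (simp add: w_def)
  then have "w = 0" using w ip_eq_zeroD by blast
  then show ?thesis using d by (auto simp: w_def D_def)
qed

section \<open>Maximal dissipative relations as inverse Cayley transforms\<close>

definition contraction :: "('a \<Rightarrow> 'a) \<Rightarrow> bool" where
  "contraction K \<longleftrightarrow> K ` V \<subseteq> V \<and> clinear_on V K \<and> (\<forall>h\<in>V. nrm (K h) \<le> nrm h)"

text \<open>The implicit form avoids inverting \<open>I - K\<close>: a pair \<open>(0, y)\<close>
  belongs to it exactly when \<open>y\<close> is a fixed vector of \<open>K\<close>, so the result
  is in general only a relation.\<close>

definition inv_cayley :: "('a \<Rightarrow> 'a) \<Rightarrow> ('a \<times> 'a) set" where
  "inv_cayley K = {u \<in> V \<times> V. K (cayley_map (- \<i>) u) = cayley_map \<i> u}"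

lemma dissipative_inv_cayley:
  assumes "contraction K"
  shows "dissipative_rel (inv_cayley K)"
proof -
  interpret P: ip_space "V \<times> V" "ip2 ip" by unfold_locales (rule inner_prod_on_ip2)
  have K: "clinear_on V K" "\<And>h. h \<in> V \<Longrightarrow> nrm (K h) \<le> nrm h"
    using assms by (auto simp: contraction_def)
  note lin = clinear_on_mem[OF K(1) subspace]
  have 0: "cayley_map c 0 = 0" for c by (simp add: cayley_map_def)
  show ?thesis
    unfolding dissipative_rel_iff
  proof (intro conjI ballI)
    show "csubspace (inv_cayley K)"
      unfolding csubspace_def inv_cayley_def
      by (intro conjI ballI allI CollectI; (elim CollectE conjE)?)
        (simp_all only: P.mem cayley_map_mem cayley_map_add cayley_map_scale lin 0)
    fix u assume "u \<in> inv_cayley K"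
    then show "nrm (cayley_map \<i> u) \<le> nrm (cayley_map (- \<i>) u)"
      using K(2)[of "cayley_map (- \<i>) u"] by (auto simp: inv_cayley_def simp del: mem_Sigma_iff)
  qed (auto simp: inv_cayley_def)
qed

text \<open>Because \<open>K\<close> is defined on the whole space, every \<open>z\<close> is
  attained by \<open>R - \<i>\<close>, and surjectivity of \<open>R - \<i>\<close> implies
  maximality.\<close>

lemma max_dissipative_inv_cayley:
  assumes K: "contraction K"
  shows "max_dissipative_rel (inv_cayley K)"
proof (rule dissipative_range_imp_max[OF dissipative_inv_cayley[OF K], of \<i>])
  fix z assume z: "z \<in> V"
  then have Kz: "K z \<in> V" using K by (auto simp: contraction_def)
  \<comment> \<open>Solution of the system \<open>y - \<i> x = z\<close>,
    \<open>y + \<i> x = K z\<close>.\<close>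
  let ?x = "(\<i>/2) *\<^sub>C (z - K z)" and ?y = "(1/2) *\<^sub>C (K z + z)"
  have y1: "?y - \<i> *\<^sub>C ?x = z"
  proof -
    have "?y - \<i> *\<^sub>C ?x = (1/2) *\<^sub>C z + (1/2) *\<^sub>C z"
      by (simp add: cscale_cscale cscale_add_right cvec.scale_right_diff_distrib algebra_simps del: half_add_half)
    then show ?thesis by simp
  qed
  have y2: "?y + \<i> *\<^sub>C ?x = K z"
  proof -
    have "?y + \<i> *\<^sub>C ?x = (1/2) *\<^sub>C K z + (1/2) *\<^sub>C K z"
      by (simp add: cscale_cscale cscale_add_right cvec.scale_right_diff_distrib algebra_simps del: half_add_half)
    then show ?thesis by simp
  qed
  have "(?x, ?y) \<in> inv_cayley K"
    using z Kz y1 y2 by (simp add: inv_cayley_def cayley_map_def)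
  with y1 show "\<exists>x y. (x, y) \<in> inv_cayley K \<and> y - \<i> *\<^sub>C x = z" by blast
qed simp

text \<open>Maximality enters twice: it makes \<open>R - \<i>\<close> onto, so that the Cayley
  transform is everywhere defined, and it upgrades the inclusion of \<open>R\<close> in the
  dissipative relation \<open>inv_cayley K\<close> to an equality.\<close>

lemma max_dissipative_imp_inv_cayley:
  assumes R: "max_dissipative_rel R"
  obtains K where "contraction K" "R = inv_cayley K"
proof -
  have dis: "csubspace R" "R \<subseteq> V \<times> V"
    "\<And>u. u \<in> R \<Longrightarrow> nrm (cayley_map \<i> u) \<le> nrm (cayley_map (- \<i>) u)"
    using R by (auto simp: max_dissipative_rel_def dissipative_rel_iff)
  let ?T = "cayley_map (- \<i>)"
  have ran: "?T ` R = V"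
  proof
    show "V \<subseteq> ?T ` R" using max_dissipative_imp_range[OF R] by blast
  qed (rule cayley_map_image[OF dis(2)])
  \<comment> \<open>By dissipativity the norm of \<open>cayley_map (- \<i>) u\<close> controls both
    components of \<open>u\<close>, so the kernel is trivial even when \<open>R\<close> is
    multivalued.\<close>
  have inj: "inj_on ?T R"
  proof (rule inj_onI)
    fix u v assume uv: "u \<in> R" "v \<in> R" "?T u = ?T v"
    obtain x y where xy: "u - v = (x, y)" by force
    have w: "(x, y) \<in> R" unfolding xy[symmetric] using uv dis(1) csubspace_diff by blast
    have "?T (x, y) = 0"
      using uv by (simp add: xy[symmetric] clinear_on_diff[OF clinear_cayley_map csubspace_UNIV])
    moreover have xyV: "(x, y) \<in> V \<times> V" using w dis(2) by blast
    moreover have "Im (ip y x) \<le> 0" using dis(3)[OF w] nrm_cayley_map_le_iff[OF xyV] by simp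
    ultimately have "(nrm x)\<^sup>2 + (nrm y)\<^sup>2 \<le> 0"
      using nrm_cayley_minus_ii[OF xyV] by simp
    then have "nrm x = 0" "nrm y = 0" by (auto simp: sum_power2_le_zero_iff)
    then have "(x, y) = 0" using w dis(2) nrm_eq_zeroD by (auto simp: zero_prod_def)
    with xy show "u = v" by simp
  qed
  define K where "K z = cayley_map \<i> (inv_into R ?T z)" for z
  have KT: "K (?T u) = cayley_map \<i> u" if "u \<in> R" for u
    using that by (simp add: K_def inv_into_f_f[OF inj])
  have invR: "inv_into R ?T z \<in> R" if "z \<in> V" for z
    using that ran inv_into_into by metis
  have K: "contraction K"
    unfolding contraction_def
  proof (intro conjI ballI)
    show "K ` V \<subseteq> V" using invR dis(2) cayley_map_mem unfolding K_def by blast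
    have "clinear_on V (inv_into R ?T)"
      using clinear_on_inv_into[OF dis(1) clinear_cayley_map inj] ran by simp
    then show "clinear_on V K"
      by (auto simp: clinear_on_def K_def cayley_map_add cayley_map_scale)
    fix h assume "h \<in> V"
    then obtain u where "u \<in> R" "h = ?T u" using ran by blast
    then show "nrm (K h) \<le> nrm h" using KT dis(3) by simp
  qed
  have "R \<subseteq> inv_cayley K" using dis(2) KT by (auto simp: inv_cayley_def simp del: mem_Sigma_iff)
  then have "R = inv_cayley K"
    using R dissipative_inv_cayley[OF K] by (auto simp: max_dissipative_rel_def)
  with K that show ?thesis by blast
qed

end

section \<open>Mixed-order duality\<close>

lemma (in ip_space) ip_eqI:
  assumes "u \<in> V" "v \<in> V" "\<And>f. f \<in> V \<Longrightarrow> ip f u = ip f v"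
  shows "u = v"
  using assms(3)[of "u - v"] ip_eq_zeroD[of "u - v"] assms(1,2) by simp

lemma mixed_duality_swap:
  "mixed_duality H ipH Hmp ipmp Hpm ippm \<Longrightarrow> mixed_duality H ipH Hpm ippm Hmp ipmp"
  unfolding mixed_duality_def by blast

text \<open>Exchanging the roles of the two spaces lets the norm estimate for \<open>Hpm\<close>
  below serve for \<open>Hmp\<close> as well.\<close>

lemma duality_pairing_swap:
  assumes "mixed_duality H ipH Hmp ipmp Hpm ippm" and "duality_pairing H ipH Hmp ipmp Hpm ippm p"
  shows "duality_pairing H ipH Hpm ippm Hmp ipmp (\<lambda>b a. cnj (p a b))"
proof -
  interpret H: ip_space H ipH
    by unfold_locales (use assms(1) in \<open>simp add: mixed_duality_def hilbert_space_def\<close>)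
  obtain C where "\<forall>a\<in>Hmp. \<forall>b\<in>Hpm. cmod (p a b) \<le> C * ipnorm ipmp a * ipnorm ippm b"
    using assms(2) unfolding duality_pairing_def by blast
  then have bdd: "\<exists>C. \<forall>b\<in>Hpm. \<forall>a\<in>Hmp. cmod (cnj (p a b)) \<le> C * ipnorm ippm b * ipnorm ipmp a"
    by (intro exI[of _ C]) (simp add: mult_ac)
  have "cnj (p a b) = ipH b a" if "b \<in> H \<inter> Hpm" "a \<in> H \<inter> Hmp" for a b
    using assms(2) that H.ip_cnj[of a b] unfolding duality_pairing_def by auto
  moreover have "p (a + a') b = p a b + p a' b" if "a \<in> Hmp" "a' \<in> Hmp" "b \<in> Hpm" for a a' b
    using assms(2) that unfolding duality_pairing_def by blast
  moreover have "p (c *\<^sub>C a) b = c * p a b" if "a \<in> Hmp" "b \<in> Hpm" for a b c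
    using assms(2) that unfolding duality_pairing_def by blast
  moreover have "p a (b + b') = p a b + p a b'" if "a \<in> Hmp" "b \<in> Hpm" "b' \<in> Hpm" for a b b'
    using assms(2) that unfolding duality_pairing_def by blast
  moreover have "p a (c *\<^sub>C b) = cnj c * p a b" if "a \<in> Hmp" "b \<in> Hpm" for a b c
    using assms(2) that unfolding duality_pairing_def by blast
  ultimately show ?thesis
    unfolding duality_pairing_def by (intro conjI bdd ballI allI) simp_all
qed

text \<open>The supremum formula for the norm is available only on \<open>H \<inter> Hpm\<close>.
  Approximating \<open>g\<close> there within \<open>d\<close> costs \<open>C * d\<close> in the
  pairing, with \<open>C\<close> a bound of the pairing, and \<open>d\<close> in the norm; both
  costs are made arbitrarily small.\<close>

lemma norm_le_of_pairing:
  assumes dual: "mixed_duality H ipH Hmp ipmp Hpm ippm"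
    and pair: "duality_pairing H ipH Hmp ipmp Hpm ippm p"
    and g: "g \<in> Hpm" and B: "B \<ge> 0"
    and le: "\<And>a. a \<in> Hmp \<Longrightarrow> cmod (p a g) \<le> B * ipnorm ipmp a"
  shows "ipnorm ippm g \<le> B"
proof (rule field_le_epsilon)
  fix e :: real assume e: "e > 0"
  interpret Hmp: ip_space Hmp ipmp
    by unfold_locales (use dual in \<open>simp add: mixed_duality_def hilbert_space_def\<close>)
  interpret Hpm: ip_space Hpm ippm
    by unfold_locales (use dual in \<open>simp add: mixed_duality_def hilbert_space_def\<close>)
  obtain C0 where C0: "\<And>a b. a \<in> Hmp \<Longrightarrow> b \<in> Hpm \<Longrightarrow> cmod (p a b) \<le> C0 * ipnorm ipmp a * ipnorm ippm b"
    using pair unfolding duality_pairing_def by blast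
  define C where "C = \<bar>C0\<bar>"
  have C: "cmod (p a b) \<le> C * ipnorm ipmp a * ipnorm ippm b" if "a \<in> Hmp" "b \<in> Hpm" for a b
  proof -
    have "C0 * (ipnorm ipmp a * ipnorm ippm b) \<le> C * (ipnorm ipmp a * ipnorm ippm b)"
      unfolding C_def using that by (intro mult_right_mono) auto
    with C0[OF that] show ?thesis by (simp add: mult_ac)
  qed
  have C_nonneg: "C \<ge> 0" by (simp add: C_def)
  \<comment> \<open>Chosen so that the total cost \<open>C * d + d\<close> is exactly
    \<open>e\<close>.\<close>
  define d where "d = e / (C + 1)"
  have d: "d > 0" using e C_nonneg by (simp add: d_def)
  then obtain g' where g': "g' \<in> H \<inter> Hpm" "ipnorm ippm (g - g') < d"
    using dual g unfolding mixed_duality_def ip_dense_def by blast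
  have "ipnorm ippm g' \<le> B + C * d"
  proof -
    have "is_sup_nonneg (ipnorm ippm g') {cmod (ipH a g') / ipnorm ipmp a | a. a \<in> H \<inter> Hmp \<and> a \<noteq> 0}"
      using dual g' unfolding mixed_duality_def by blast
    moreover have "cmod (ipH a g') / ipnorm ipmp a \<le> B + C * d" if a: "a \<in> H \<inter> Hmp" "a \<noteq> 0" for a
    proof -
      have pos: "ipnorm ipmp a > 0" using Hmp.nrm_pos a by auto
      have "p a g' + p a (g - g') = p a g"
        using pair a g g' unfolding duality_pairing_def
        by (metis Hpm.mem(5) IntD2 add_diff_cancel_left' diff_add_cancel add.commute)
      then have "cmod (p a g') \<le> cmod (p a g) + cmod (p a (g - g'))"
        using norm_triangle_ineq4[of "p a g" "p a (g - g')"] by (simp add: eq_diff_eq[symmetric])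
      also have "\<dots> \<le> B * ipnorm ipmp a + C * ipnorm ipmp a * ipnorm ippm (g - g')"
        using a g g' by (intro add_mono le C) auto
      also have "\<dots> \<le> B * ipnorm ipmp a + C * ipnorm ipmp a * d"
        using g' pos C_nonneg by (intro add_left_mono mult_left_mono) auto
      finally have "cmod (p a g') \<le> (B + C * d) * ipnorm ipmp a" by (simp add: algebra_simps)
      moreover have "p a g' = ipH a g'"
        using pair a g' unfolding duality_pairing_def by blast
      ultimately show ?thesis using pos by (simp add: field_simps)
    qed
    moreover have "B + C * d \<ge> 0" using B C_nonneg d by simp
    ultimately show ?thesis unfolding is_sup_nonneg_def by blast
  qed
  then have "ipnorm ippm g \<le> B + C * d + d"
    using Hpm.nrm_le_add_diff[of g g'] g g' by auto
  moreover have "(C + 1) * d = e" using C_nonneg by (simp add: d_def)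
  then have "C * d + d = e" by (simp add: distrib_right)
  ultimately show "ipnorm ippm g \<le> B + e" by simp
qed

text \<open>This is \<open>norm_le_of_pairing\<close> with bound 0, after exchanging the two
  spaces.\<close>

lemma pairing_nondegenerate:
  assumes dual: "mixed_duality H ipH Hmp ipmp Hpm ippm"
    and pair: "duality_pairing H ipH Hmp ipmp Hpm ippm p"
    and a: "a \<in> Hmp" and zero: "\<And>b. b \<in> Hpm \<Longrightarrow> p a b = 0"
  shows "a = 0"
proof -
  interpret Hmp: ip_space Hmp ipmp
    by unfold_locales (use dual in \<open>simp add: mixed_duality_def hilbert_space_def\<close>)
  have "ipnorm ipmp a \<le> 0"
    by (rule norm_le_of_pairing[OF mixed_duality_swap[OF dual] duality_pairing_swap[OF dual pair] a])
      (simp_all add: zero)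
  then show ?thesis using a Hmp.nrm_pos by force
qed

section \<open>The map \<open>V#\<close> and the transfer of relations to \<open>H\<close>\<close>

locale dual_homeo =
  fixes H Hmp Hpm :: "'h::cvec set" and ipH ipmp ippm p :: "'h \<Rightarrow> 'h \<Rightarrow> complex" and V :: "'h \<Rightarrow> 'h"
  assumes dual: "mixed_duality H ipH Hmp ipmp Hpm ippm"
    and pair: "duality_pairing H ipH Hmp ipmp Hpm ippm p"
    and homeo: "lin_homeo ipH H ipmp Hmp V"
begin

sublocale H: hilbert H ipH
  by unfold_locales (use dual in \<open>simp add: mixed_duality_def\<close>)

sublocale Hmp: hilbert Hmp ipmp
  by unfold_locales (use dual in \<open>simp add: mixed_duality_def\<close>)

sublocale Hpm: hilbert Hpm ippm
  by unfold_locales (use dual in \<open>simp add: mixed_duality_def\<close>)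

lemma p_add_left: "a \<in> Hmp \<Longrightarrow> a' \<in> Hmp \<Longrightarrow> b \<in> Hpm \<Longrightarrow> p (a + a') b = p a b + p a' b"
  and p_scale_left: "a \<in> Hmp \<Longrightarrow> b \<in> Hpm \<Longrightarrow> p (c *\<^sub>C a) b = c * p a b"
  and p_add_right: "a \<in> Hmp \<Longrightarrow> b \<in> Hpm \<Longrightarrow> b' \<in> Hpm \<Longrightarrow> p a (b + b') = p a b + p a b'"
  and p_scale_right: "a \<in> Hmp \<Longrightarrow> b \<in> Hpm \<Longrightarrow> p a (c *\<^sub>C b) = cnj c * p a b"
  using pair unfolding duality_pairing_def by blast+

lemma p_uminus_right: "a \<in> Hmp \<Longrightarrow> b \<in> Hpm \<Longrightarrow> p a (- b) = - p a b"
  using p_scale_right[of a b "-1"] by simp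

lemma V_lin: "clinear_on H V" and V_inj: "inj_on V H" and V_img: "V ` H = Hmp"
  using homeo by (auto simp: lin_homeo_def)

lemma V_mem [simp]: "f \<in> H \<Longrightarrow> V f \<in> Hmp"
  using V_img by blast

definition Vi :: "'h \<Rightarrow> 'h" where "Vi = inv_into H V"

lemma Vi_V [simp]: "f \<in> H \<Longrightarrow> Vi (V f) = f"
  by (simp add: Vi_def V_inj)

lemma Vi_mem [simp]: "a \<in> Hmp \<Longrightarrow> Vi a \<in> H"
  and V_Vi [simp]: "a \<in> Hmp \<Longrightarrow> V (Vi a) = a"
  by (auto simp: Vi_def inv_into_into f_inv_into_f simp flip: V_img)

lemma Vi_lin: "clinear_on Hmp Vi"
  using clinear_on_inv_into[OF H.subspace V_lin V_inj] by (simp add: Vi_def V_img)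

lemma bound_nonneg:
  assumes "bounded_on ipA A ipB f" "\<And>x. x \<in> A \<Longrightarrow> 0 \<le> ipnorm ipA x"
  obtains C where "C \<ge> 0" "\<And>x. x \<in> A \<Longrightarrow> ipnorm ipB (f x) \<le> C * ipnorm ipA x"
proof -
  obtain C0 where C0: "\<And>x. x \<in> A \<Longrightarrow> ipnorm ipB (f x) \<le> C0 * ipnorm ipA x"
    using assms(1) by (auto simp: bounded_on_def)
  have "ipnorm ipB (f x) \<le> \<bar>C0\<bar> * ipnorm ipA x" if "x \<in> A" for x
    using C0[OF that] mult_right_mono[OF abs_ge_self[of C0] assms(2)[OF that]] by linarith
  then show ?thesis using that[of "\<bar>C0\<bar>"] by simp
qed

lemma p_V_bounded:
  obtains C where "C \<ge> 0" "\<And>f g. f \<in> H \<Longrightarrow> g \<in> Hpm \<Longrightarrow> cmod (p (V f) g) \<le> C * ipnorm ippm g * ipnorm ipH f"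
proof -
  obtain C1 where C1: "\<And>a b. a \<in> Hmp \<Longrightarrow> b \<in> Hpm \<Longrightarrow> cmod (p a b) \<le> C1 * ipnorm ipmp a * ipnorm ippm b"
    using pair unfolding duality_pairing_def by blast
  obtain C2 where C2: "C2 \<ge> 0" "\<And>f. f \<in> H \<Longrightarrow> ipnorm ipmp (V f) \<le> C2 * ipnorm ipH f"
    using homeo bound_nonneg[of ipH H ipmp V] by (auto simp: lin_homeo_def)
  have "cmod (p (V f) g) \<le> (\<bar>C1\<bar> * C2) * ipnorm ippm g * ipnorm ipH f" if "f \<in> H" "g \<in> Hpm" for f g
  proof -
    have "cmod (p (V f) g) \<le> C1 * (ipnorm ipmp (V f) * ipnorm ippm g)"
      using C1[of "V f" g] that by (simp add: mult_ac)
    also have "\<dots> \<le> \<bar>C1\<bar> * ((C2 * ipnorm ipH f) * ipnorm ippm g)"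
      using that C2 by (intro mult_mono mult_right_mono mult_nonneg_nonneg) auto
    finally show ?thesis by (simp add: mult_ac)
  qed
  then show ?thesis using that[of "\<bar>C1\<bar> * C2"] C2 by simp
qed

abbreviation Vsharp :: "'h \<Rightarrow> 'h" where "Vsharp \<equiv> vsharp H ipH p V"

text \<open>Riesz representation of the bounded functional \<open>f \<mapsto> p (V f) g\<close>
  supplies the vector, which makes the definite description in \<open>vsharp\<close>
  meaningful.\<close>

lemma vsharp_props:
  assumes g: "g \<in> Hpm"
  shows Vsharp_mem [simp]: "Vsharp g \<in> H" and Vsharp_pair: "\<And>f. f \<in> H \<Longrightarrow> p (V f) g = ipH f (Vsharp g)"
proof -
  obtain C where C: "\<And>f. f \<in> H \<Longrightarrow> cmod (p (V f) g) \<le> C * ipnorm ippm g * ipnorm ipH f"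
    using p_V_bounded g by metis
  obtain u where u: "u \<in> H" "\<And>f. f \<in> H \<Longrightarrow> p (V f) g = ipH f u"
    by (rule H.riesz[of "\<lambda>f. p (V f) g" "C * ipnorm ippm g"])
      (use g C in \<open>auto simp: clinear_on_mem[OF V_lin H.subspace] p_add_left p_scale_left\<close>)
  have "\<exists>!u. u \<in> H \<and> (\<forall>f\<in>H. p (V f) g = ipH f u)"
    using u H.ip_eqI by (intro ex1I[of _ u]) auto
  from theI'[OF this] show "Vsharp g \<in> H" "\<And>f. f \<in> H \<Longrightarrow> p (V f) g = ipH f (Vsharp g)"
    by (auto simp: vsharp_def)
qed

lemma Vsharp_lin: "clinear_on Hpm Vsharp"
  unfolding clinear_on_def
  by (auto intro!: H.ip_eqI simp: Vsharp_pair[symmetric] p_add_right p_scale_right)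

text \<open>Writing \<open>a = V (Vi a)\<close> turns the pairing of \<open>a\<close> with
  \<open>g\<close> into an inner product with \<open>V# g\<close>, and
  \<open>norm_le_of_pairing\<close> gives a lower bound for \<open>V#\<close>. A vector
  \<open>y\<close> orthogonal to the range makes \<open>V y\<close> pair to zero with all of
  \<open>Hpm\<close>, so \<open>V y = 0\<close> and \<open>y = 0\<close>.\<close>

lemma bij_Vsharp: "inj_on Vsharp Hpm" "Vsharp ` Hpm = H"
proof -
  obtain CI where CI: "CI \<ge> 0" "\<And>a. a \<in> Hmp \<Longrightarrow> ipnorm ipH (Vi a) \<le> CI * ipnorm ipmp a"
    using homeo bound_nonneg[of ipmp Hmp ipH Vi] by (auto simp: lin_homeo_def Vi_def)
  obtain C where C: "C \<ge> 0" "\<And>f g. f \<in> H \<Longrightarrow> g \<in> Hpm \<Longrightarrow> cmod (p (V f) g) \<le> C * ipnorm ippm g * ipnorm ipH f"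
    using p_V_bounded by metis
  have below: "ipnorm ippm g \<le> CI * ipnorm ipH (Vsharp g)" if g: "g \<in> Hpm" for g
  proof (rule norm_le_of_pairing[OF dual pair g])
    show "0 \<le> CI * ipnorm ipH (Vsharp g)" using CI g by simp
    fix a assume a: "a \<in> Hmp"
    have "cmod (p a g) = cmod (ipH (Vi a) (Vsharp g))"
      using Vsharp_pair[OF g, of "Vi a"] a by simp
    also have "\<dots> \<le> ipnorm ipH (Vi a) * ipnorm ipH (Vsharp g)"
      using a g by (intro H.Cauchy_Schwarz) auto
    also have "\<dots> \<le> (CI * ipnorm ipmp a) * ipnorm ipH (Vsharp g)"
      using a g CI by (intro mult_right_mono) auto
    finally show "cmod (p a g) \<le> CI * ipnorm ipH (Vsharp g) * ipnorm ipmp a" by (simp add: mult_ac)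
  qed
  \<comment> \<open>Test the defining identity of \<open>V#\<close> with \<open>f = V# g\<close> and
    cancel one factor of the norm.\<close>
  have above: "ipnorm ipH (Vsharp g) \<le> C * ipnorm ippm g" if g: "g \<in> Hpm" for g
  proof (cases "Vsharp g = 0")
    case False
    then have pos: "ipnorm ipH (Vsharp g) > 0" using g by (intro H.nrm_pos) auto
    have "(ipnorm ipH (Vsharp g))\<^sup>2 = cmod (p (V (Vsharp g)) g)"
      using g Vsharp_pair[OF g, of "Vsharp g"] by (simp add: H.ip_self norm_power)
    also have "\<dots> \<le> C * ipnorm ippm g * ipnorm ipH (Vsharp g)" using C g by simp
    finally show ?thesis using pos by (simp add: power2_eq_square)
  qed (use C g in simp)
  show "Vsharp ` Hpm = H"
  proof (rule Hpm.bounded_below_surj[OF H.ip_space Vsharp_lin _ below above])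
    fix y assume y: "y \<in> H" "\<And>g. g \<in> Hpm \<Longrightarrow> ipH y (Vsharp g) = 0"
    have "V y = 0"
      by (rule pairing_nondegenerate[OF dual pair]) (use y Vsharp_pair in auto)
    then have "Vi (V y) = 0" using clinear_on_zero[OF Vi_lin Hmp.subspace] by simp
    then show "y = 0" using y by simp
  qed auto
  show "inj_on Vsharp Hpm"
  proof (rule inj_onI)
    fix g g' assume g: "g \<in> Hpm" "g' \<in> Hpm" "Vsharp g = Vsharp g'"
    then have "ipnorm ippm (g - g') \<le> 0"
      using below[of "g - g'"] by (simp add: clinear_on_diff[OF Vsharp_lin Hpm.subspace])
    then have "g - g' = 0" using g Hpm.nrm_pos[of "g - g'"] by force
    then show "g = g'" by simp
  qed
qed

text \<open>The factor \<open>- \<i>\<close> turns the real part in accretivity into the imaginary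
  part in dissipativity. The graph of \<open>Z\<close> is carried to the graph of
  \<open>T = - \<i> V# Z V\<close>.\<close>

definition to_H :: "'h \<times> 'h \<Rightarrow> 'h \<times> 'h" where
  "to_H u = (Vi (fst u), - (\<i> *\<^sub>C Vsharp (snd u)))"

lemma to_H_mem [simp]: "u \<in> Hmp \<times> Hpm \<Longrightarrow> to_H u \<in> H \<times> H"
  by (auto simp: to_H_def)

lemma csubspace_Hmp_Hpm: "csubspace (Hmp \<times> Hpm)"
  unfolding csubspace_def by (simp add: mem_Times_iff)

lemma to_H_lin: "clinear_on (Hmp \<times> Hpm) to_H"
  unfolding clinear_on_def
  by (simp add: to_H_def mem_Times_iff cscale_Pair clinear_on_add[OF Vi_lin Hmp.subspace]
      clinear_on_scale[OF Vi_lin Hmp.subspace] clinear_on_add[OF Vsharp_lin Hpm.subspace]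
      clinear_on_scale[OF Vsharp_lin Hpm.subspace] cscale_add_right cscale_cscale mult.commute)

lemma to_H_inj: "inj_on to_H (Hmp \<times> Hpm)"
proof (rule inj_onI)
  fix u v assume u: "u \<in> Hmp \<times> Hpm" and v: "v \<in> Hmp \<times> Hpm" and eq: "to_H u = to_H v"
  then have "V (Vi (fst u)) = V (Vi (fst v))" "Vsharp (snd u) = Vsharp (snd v)" by (auto simp: to_H_def)
  then show "u = v" using u v inj_onD[OF bij_Vsharp(1)] by (auto simp: prod_eq_iff)
qed

lemma to_H_img: "to_H ` (Hmp \<times> Hpm) = H \<times> H"
proof
  show "H \<times> H \<subseteq> to_H ` (Hmp \<times> Hpm)"
  proof
    fix u assume u: "u \<in> H \<times> H"
    then have "\<i> *\<^sub>C snd u \<in> Vsharp ` Hpm" unfolding bij_Vsharp by auto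
    then obtain g where g: "g \<in> Hpm" "Vsharp g = \<i> *\<^sub>C snd u" by force
    then have "to_H (V (fst u), g) = u" using u by (auto simp: to_H_def cscale_cscale)
    moreover have "(V (fst u), g) \<in> Hmp \<times> Hpm" using u g by auto
    ultimately show "u \<in> to_H ` (Hmp \<times> Hpm)" by (metis imageI)
  qed
qed (use to_H_mem in blast)

lemma to_H_form:
  assumes "(a, b) \<in> Hmp \<times> Hpm"
  shows "Im (ipH (snd (to_H (a, b))) (fst (to_H (a, b)))) = - Re (cnj (p a b))"
proof -
  have "p a b = ipH (Vi a) (Vsharp b)" using Vsharp_pair[of b "Vi a"] assms by simp
  then show ?thesis using assms H.ip_cnj[of "Vi a" "Vsharp b"] by (simp add: to_H_def)
qed

definition pullback :: "('h \<times> 'h) set \<Rightarrow> ('h \<times> 'h) set" where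
  "pullback R = {u \<in> Hmp \<times> Hpm. to_H u \<in> R}"

lemma pullback_image: "\<Phi> \<subseteq> Hmp \<times> Hpm \<Longrightarrow> pullback (to_H ` \<Phi>) = \<Phi>"
  unfolding pullback_def using inj_onD[OF to_H_inj] by blast

lemma image_pullback: "R \<subseteq> H \<times> H \<Longrightarrow> to_H ` pullback R = R"
proof (intro equalityI subsetI)
  fix x assume R: "R \<subseteq> H \<times> H" and x: "x \<in> R"
  then have "x \<in> to_H ` (Hmp \<times> Hpm)" unfolding to_H_img by (rule subsetD)
  then obtain u where "u \<in> Hmp \<times> Hpm" "x = to_H u" by (rule imageE)
  with x show "x \<in> to_H ` pullback R" unfolding pullback_def by blast
qed (auto simp: pullback_def)

lemma dissipative_image:
  assumes "linrel Hmp Hpm \<Phi>" "accretive_rel p \<Phi>"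
  shows "H.dissipative_rel (to_H ` \<Phi>)"
proof -
  have \<Phi>: "csubspace \<Phi>" "\<Phi> \<subseteq> Hmp \<times> Hpm" using assms by (auto simp: linrel_def)
  note lin = clinear_on_mem[OF to_H_lin csubspace_Hmp_Hpm]
  have "csubspace (to_H ` \<Phi>)"
    unfolding csubspace_def
  proof (intro conjI ballI allI)
    show "0 \<in> to_H ` \<Phi>" using csubspace_zero[OF \<Phi>(1)] lin(3) by force
    fix x c assume "x \<in> to_H ` \<Phi>"
    then obtain u where u: "u \<in> \<Phi>" "x = to_H u" by blast
    then have "c *\<^sub>C x = to_H (c *\<^sub>C u)" using \<Phi>(2) lin(2) by auto
    then show "c *\<^sub>C x \<in> to_H ` \<Phi>" using csubspace_scale[OF \<Phi>(1) u(1)] by blast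
    fix y assume "y \<in> to_H ` \<Phi>"
    then obtain v where v: "v \<in> \<Phi>" "y = to_H v" by blast
    have "u \<in> Hmp \<times> Hpm" "v \<in> Hmp \<times> Hpm" using u v \<Phi>(2) by blast+
    with u v have "x + y = to_H (u + v)" by (simp only: lin(1))
    then show "x + y \<in> to_H ` \<Phi>" using csubspace_add[OF \<Phi>(1) u(1) v(1)] by blast
  qed
  moreover have "to_H ` \<Phi> \<subseteq> H \<times> H" using \<Phi>(2) to_H_mem by blast
  moreover have "Im (ipH y x) \<le> 0" if xy: "(x, y) \<in> to_H ` \<Phi>" for x y
  proof -
    obtain a b where ab: "(a, b) \<in> \<Phi>" "(x, y) = to_H (a, b)" using xy by auto
    then have "0 \<le> Re (cnj (p a b))" "(a, b) \<in> Hmp \<times> Hpm"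
      using assms(2) \<Phi>(2) unfolding accretive_rel_def by blast+
    then show ?thesis using to_H_form[of a b] ab(2) by (simp add: prod_eq_iff)
  qed
  ultimately show ?thesis unfolding H.dissipative_rel_def by blast
qed

lemma accretive_pullback:
  assumes "H.dissipative_rel R"
  shows "linrel Hmp Hpm (pullback R)" "accretive_rel p (pullback R)"
proof -
  have R: "csubspace R" "R \<subseteq> H \<times> H" using assms by (auto simp: H.dissipative_rel_def)
  note lin = clinear_on_mem[OF to_H_lin csubspace_Hmp_Hpm]
  have "csubspace (pullback R)"
    unfolding csubspace_def pullback_def
    by (intro conjI ballI allI CollectI; (elim CollectE conjE)?)
      (simp_all only: lin csubspace_mem[OF R(1)] csubspace_mem[OF csubspace_Hmp_Hpm])
  then show "linrel Hmp Hpm (pullback R)" by (auto simp: linrel_def pullback_def)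
  have "0 \<le> Re (cnj (p a b))" if "(a, b) \<in> pullback R" for a b
  proof -
    have "(fst (to_H (a, b)), snd (to_H (a, b))) \<in> R" using that by (simp add: pullback_def)
    then have "Im (ipH (snd (to_H (a, b))) (fst (to_H (a, b)))) \<le> 0"
      using assms unfolding H.dissipative_rel_def by blast
    then show ?thesis using to_H_form[of a b] that by (simp add: pullback_def)
  qed
  then show "accretive_rel p (pullback R)" by (auto simp: accretive_rel_def)
qed

text \<open>\<open>pullback\<close> undoes taking images under \<open>to_H\<close>, and both respect
  inclusion; a dissipative relation above the image therefore pulls back to an accretive relation
  above \<open>\<Phi>\<close>.\<close>

lemma max_dissipative_image:
  assumes "max_accretive_rel Hmp Hpm p \<Phi>"
  shows "H.max_dissipative_rel (to_H ` \<Phi>)"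
  unfolding H.max_dissipative_rel_def
proof (intro conjI allI impI)
  have \<Phi>: "linrel Hmp Hpm \<Phi>" "accretive_rel p \<Phi>"
    "\<And>\<Psi>. linrel Hmp Hpm \<Psi> \<Longrightarrow> accretive_rel p \<Psi> \<Longrightarrow> \<Phi> \<subseteq> \<Psi> \<Longrightarrow> \<Psi> = \<Phi>"
    using assms by (auto simp: max_accretive_rel_def)
  then have sub: "\<Phi> \<subseteq> Hmp \<times> Hpm" by (simp add: linrel_def)
  show "H.dissipative_rel (to_H ` \<Phi>)" using dissipative_image \<Phi> by blast
  fix R assume R: "H.dissipative_rel R \<and> to_H ` \<Phi> \<subseteq> R"
  then have "pullback R = \<Phi>"
    using accretive_pullback[of R] sub by (intro \<Phi>(3)) (auto simp: pullback_def)
  then show "R = to_H ` \<Phi>" using R image_pullback[of R] by (auto simp: H.dissipative_rel_def)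
qed

lemma max_accretive_pullback:
  assumes "H.max_dissipative_rel R"
  shows "max_accretive_rel Hmp Hpm p (pullback R)"
  unfolding max_accretive_rel_def
proof (intro conjI allI impI)
  have R: "H.dissipative_rel R" "\<And>R'. H.dissipative_rel R' \<Longrightarrow> R \<subseteq> R' \<Longrightarrow> R' = R"
    using assms by (auto simp: H.max_dissipative_rel_def)
  show "linrel Hmp Hpm (pullback R)" "accretive_rel p (pullback R)" using accretive_pullback[OF R(1)] by auto
  fix \<Psi> assume \<Psi>: "linrel Hmp Hpm \<Psi> \<and> accretive_rel p \<Psi> \<and> pullback R \<subseteq> \<Psi>"
  have "R \<subseteq> to_H ` \<Psi>"
    using \<Psi> image_pullback[of R] R(1) unfolding H.dissipative_rel_def by blast
  then have "to_H ` \<Psi> = R" using \<Psi> by (intro R(2) dissipative_image) auto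
  then show "\<Psi> = pullback R" using \<Psi> pullback_image[of \<Psi>] by (simp add: linrel_def)
qed

end

section \<open>Boundary values and extensions\<close>

text \<open>If \<open>h\<close> were nonzero, some \<open>f\<close> in \<open>D\<close> would be
  closer to \<open>h\<close> than 0 is; as \<open>f\<close> is orthogonal to \<open>h\<close>,
  Cauchy-Schwarz for \<open>h - f\<close> and \<open>h\<close> gives a contradiction. It is what
  makes the adjoint single valued.\<close>

lemma (in ip_space) dense_orth_zero:
  assumes dense: "ip_dense ip V D" and h: "h \<in> V" and orth: "\<And>f. f \<in> D \<Longrightarrow> ip f h = 0"
  shows "h = 0"
proof (rule ccontr)
  assume "h \<noteq> 0"
  then have pos: "nrm h > 0" using nrm_pos h by blast
  then obtain f where f: "f \<in> D" "nrm (h - f) < nrm h"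
    using dense h unfolding ip_dense_def by blast
  then have fV: "f \<in> V" using dense by (auto simp: ip_dense_def)
  have "(nrm h)\<^sup>2 = cmod (ip (h - f) h)"
    using orth[OF f(1)] fV h by (simp add: ip_self norm_power)
  also have "\<dots> \<le> nrm (h - f) * nrm h" using fV h by (intro Cauchy_Schwarz) auto
  also have "\<dots> < nrm h * nrm h" using f pos by simp
  finally show False by (simp add: power2_eq_square)
qed

section \<open>The weighted inner product on the product space\<close>

locale weighted =
  fixes ipX :: "'x::cvec \<Rightarrow> 'x \<Rightarrow> complex" and S :: "'x \<times> 'x \<Rightarrow> 'x \<times> 'x"
  assumes X: "hilbert_space UNIV ipX" and S: "bdd_unif_pos_sa ipX S"
begin

sublocale X: hilbert UNIV ipX
  by unfold_locales (rule X)

sublocale X2: hilbert UNIV "ip2 ipX"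
  using X.hilbert_ip2 by unfold_locales simp

lemma S_lin: "clinear_on UNIV S" and S_sym: "ip2 ipX (S u) v = ip2 ipX u (S v)"
  using S unfolding bdd_unif_pos_sa_def by blast+

lemma S_above:
  obtains C where "C > 0" "\<And>u. X2.nrm (S u) \<le> C * X2.nrm u"
proof -
  obtain C0 where C0: "\<And>x. X2.nrm (S x) \<le> C0 * X2.nrm x"
    using S by (auto simp: bdd_unif_pos_sa_def bounded_on_def)
  have "X2.nrm (S x) \<le> (\<bar>C0\<bar> + 1) * X2.nrm x" for x
    using C0[of x] mult_right_mono[of C0 "\<bar>C0\<bar> + 1" "X2.nrm x"] X2.nrm_nonneg[of x] by force
  then show ?thesis using that[of "\<bar>C0\<bar> + 1"] by simp
qed

lemma S_below:
  obtains c where "c > 0" "\<And>u. c * (X2.nrm u)\<^sup>2 \<le> Re (ip2 ipX (S u) u)"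
  using S unfolding bdd_unif_pos_sa_def by blast

lemma S_nrm_below:
  obtains c where "c > 0" "\<And>u. X2.nrm u \<le> c * X2.nrm (S u)"
proof -
  obtain c where c: "c > 0" "\<And>u. c * (X2.nrm u)\<^sup>2 \<le> Re (ip2 ipX (S u) u)" using S_below by blast
  have "X2.nrm u \<le> (1 / c) * X2.nrm (S u)" for u
  proof (cases "u = 0")
    case False
    then have pos: "X2.nrm u > 0" using X2.nrm_pos by blast
    have "c * (X2.nrm u)\<^sup>2 \<le> X2.nrm (S u) * X2.nrm u"
      using c(2)[of u] X2.Cauchy_Schwarz[of "S u" u] complex_Re_le_cmod[of "ip2 ipX (S u) u"] by simp
    then show ?thesis using pos c(1) by (simp add: power2_eq_square field_simps)
  qed (use c in simp)
  then show ?thesis using c that[of "1 / c"] by simp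
qed

text \<open>Uniform positivity bounds \<open>S\<close> below, which gives injectivity and a complete
  range; by symmetry a vector orthogonal to the range lies in the kernel. Hence \<open>inv S\<close>
  in \<open>Mst\<close> is a genuine inverse.\<close>

lemma S_bij: "bij S"
proof (rule bijI)
  obtain c where c: "c > 0" "\<And>u. X2.nrm u \<le> c * X2.nrm (S u)" using S_nrm_below by blast
  obtain C where C: "C > 0" "\<And>u. X2.nrm (S u) \<le> C * X2.nrm u" using S_above by blast
  note lin = clinear_on_mem[OF S_lin csubspace_UNIV]
  have zero: "u = 0" if "S u = 0" for u
    using c(2)[of u] that X2.nrm_pos[of u] by force
  show "inj S"
  proof (rule injI)
    fix x y assume "S x = S y"
    then have "x - y = 0" using zero[of "x - y"] lin(5)[of x y] by simp
    then show "x = y" by simp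
  qed
  show "surj S"
  proof (rule X2.bounded_below_surj[OF X2.ip_space S_lin _ c(2) C(2)])
    fix y assume "\<And>x. x \<in> UNIV \<Longrightarrow> ip2 ipX y (S x) = 0"
    then have "ip2 ipX (S y) (S y) = 0" using S_sym[of y "S y"] by simp
    then show "y = 0" using zero X2.ip_eq_zeroD by blast
  qed simp
qed

lemma inv_S_S [simp]: "inv S (S u) = u" and S_inv_S [simp]: "S (inv S u) = u"
  using S_bij by (simp_all add: bij_is_inj bij_is_surj surj_f_inv_f)

lemma inv_S_lin: "clinear_on UNIV (inv S)"
  using clinear_on_inv_into[OF csubspace_UNIV S_lin bij_is_inj[OF S_bij]] bij_is_surj[OF S_bij] by simp

lemma inner_prod_on_ipS: "inner_prod_on UNIV (ipS ipX S)"
proof -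
  note lin = clinear_on_mem[OF S_lin csubspace_UNIV]
  obtain c where c: "c > 0" "\<And>u. c * (X2.nrm u)\<^sup>2 \<le> Re (ip2 ipX (S u) u)" using S_below by blast
  have sym: "ip2 ipX (S y) x = cnj (ip2 ipX (S x) y)" for x y
    using S_sym[of y x] X2.ip_cnj[of "S x" y] by simp
  have nonneg: "0 \<le> Re (ip2 ipX (S u) u)" for u
    using c(1) c(2)[of u] by (meson less_imp_le order_trans mult_nonneg_nonneg zero_le_power2)
  have def: "u = 0" if "ip2 ipX (S u) u = 0" for u
  proof -
    have "X2.nrm u = 0" using c(1) c(2)[of u] that by (simp add: mult_le_0_iff)
    then show ?thesis using X2.nrm_eq_zeroD by blast
  qed
  show ?thesis
    unfolding inner_prod_on_def ipS_def
    by (intro conjI ballI allI impI;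
        (rule csubspace_UNIV nonneg sym | rule def; assumption | simp add: lin))
qed

text \<open>The weighted and the unweighted norm are equivalent, so completeness passes along the
  identity map. The square roots arise because the bounds on \<open>S\<close> concern squared
  norms.\<close>

lemma hilbert_ipS: "hilbert_space UNIV (ipS ipX S)"
proof -
  obtain c where c: "c > 0" "\<And>u. c * (X2.nrm u)\<^sup>2 \<le> Re (ip2 ipX (S u) u)" using S_below by blast
  obtain C where C: "C > 0" "\<And>u. X2.nrm (S u) \<le> C * X2.nrm u" using S_above by blast
  interpret Y: ip_space UNIV "ipS ipX S" by unfold_locales (rule inner_prod_on_ipS)
  have sq: "(Y.nrm u)\<^sup>2 = Re (ip2 ipX (S u) u)" for u
    using Y.nrm_sq[of u] by (simp add: ipS_def)
  have "hilbert_space (id ` UNIV) (ipS ipX S)"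
  proof (rule X2.range_hilbert[OF inner_prod_on_ipS])
    fix u
    have "(X2.nrm u)\<^sup>2 \<le> (1 / c) * (Y.nrm u)\<^sup>2" using c by (simp add: sq field_simps)
    also have "\<dots> = (sqrt (1 / c) * Y.nrm u)\<^sup>2" using c by (simp add: power_mult_distrib)
    finally show "X2.nrm u \<le> sqrt (1 / c) * Y.nrm (id u)"
      using c by (auto intro: power2_le_imp_le)
    have "(Y.nrm u)\<^sup>2 \<le> X2.nrm (S u) * X2.nrm u"
      unfolding sq using X2.Cauchy_Schwarz[of "S u" u] complex_Re_le_cmod[of "ip2 ipX (S u) u"] by simp
    also have "\<dots> \<le> (C * X2.nrm u) * X2.nrm u" using C(2)[of u] by (intro mult_right_mono) auto
    also have "\<dots> = (sqrt C * X2.nrm u)\<^sup>2" using C by (simp add: power_mult_distrib power2_eq_square)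
    finally show "Y.nrm (id u) \<le> sqrt C * X2.nrm u"
      using C by (auto intro: power2_le_imp_le)
  qed (auto simp: clinear_on_def)
  then show ?thesis by simp
qed

sublocale Y: hilbert UNIV "ipS ipX S"
  by unfold_locales (rule hilbert_ipS)

end

section \<open>Boundary values and restrictions of the adjoint\<close>

locale reduced = weighted ipX S + dual_homeo H Hmp Hpm ipH ipmp ippm p V
  for ipX :: "'x::cvec \<Rightarrow> 'x \<Rightarrow> complex" and S :: "'x \<times> 'x \<Rightarrow> 'x \<times> 'x"
    and H Hmp Hpm :: "'h::cvec set" and ipH ipmp ippm p :: "'h \<Rightarrow> 'h \<Rightarrow> complex" and V :: "'h \<Rightarrow> 'h" +
  fixes DA :: "'x set" and A :: "'x \<Rightarrow> 'x" and G :: "'x \<Rightarrow> 'h" and W :: "'h \<Rightarrow> 'h"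
  assumes A: "closed_dd_symmetric ipX DA A"
    and red: "reduction_tuple ipX DA A Hmp ipmp Hpm ippm p G W"
begin

abbreviation "Dst \<equiv> adj_dom ipX DA A"
abbreviation "Ast \<equiv> adj ipX DA A"
abbreviation "M2 \<equiv> Mst_dom ipX DA A"
abbreviation "Ms \<equiv> Mst ipX DA A S"

lemma dense_DA: "ip_dense ipX UNIV DA"
  using A by (simp add: closed_dd_symmetric_def)

text \<open>Density of \<open>DA\<close> makes the representing vector unique, so the definite
  description in \<open>adj\<close> returns \<open>h\<close>.\<close>

lemma adjI:
  assumes "\<And>f. f \<in> DA \<Longrightarrow> ipX (A f) g = ipX f h"
  shows "g \<in> Dst" "Ast g = h"
proof -
  show "g \<in> Dst" using assms by (auto simp: adj_dom_def)
  have "h' = h" if "\<forall>f\<in>DA. ipX (A f) g = ipX f h'" for h'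
    using X.dense_orth_zero[OF dense_DA, of "h' - h"] that assms by simp
  then show "Ast g = h" unfolding adj_def using assms by (intro the_equality) auto
qed

lemma adjD: "g \<in> Dst \<Longrightarrow> f \<in> DA \<Longrightarrow> ipX (A f) g = ipX f (Ast g)"
  using adjI(2) unfolding adj_dom_def by blast

lemma adj_add:
  assumes "g \<in> Dst" "h \<in> Dst"
  shows "g + h \<in> Dst" "Ast (g + h) = Ast g + Ast h"
  using adjI[of "g + h" "Ast g + Ast h"] adjD assms by auto

lemma adj_scale:
  assumes "g \<in> Dst"
  shows "c *\<^sub>C g \<in> Dst" "Ast (c *\<^sub>C g) = c *\<^sub>C Ast g"
  using adjI[of "c *\<^sub>C g" "c *\<^sub>C Ast g"] adjD assms by auto

lemma adj_A: "g \<in> DA \<Longrightarrow> g \<in> Dst" "g \<in> DA \<Longrightarrow> Ast g = A g"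
  using adjI[of g "A g"] A by (auto simp: closed_dd_symmetric_def)

lemma csubspace_Dst: "csubspace Dst"
  using adjI(1)[of 0 0] by (auto simp: csubspace_def adj_add adj_scale)

lemma csubspace_M2: "csubspace M2"
  using csubspace_Dst by (auto simp: csubspace_def Mst_dom_def cscale_prod_def zero_prod_def)

lemma G_lin: "clinear_on Dst G" and G_img: "G ` Dst = Hmp"
  and W_lin: "clinear_on Hmp W" and W_img: "W ` Hmp = Hpm"
  and green: "\<And>f g. f \<in> Dst \<Longrightarrow> g \<in> Dst \<Longrightarrow> ipX (Ast f) g - ipX f (Ast g) = p (G f) (W (G g))"
  using red by (auto simp: reduction_tuple_def lin_homeo_def)

lemma G_mem [simp]: "f \<in> Dst \<Longrightarrow> G f \<in> Hmp"
  using G_img by blast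

lemma W_mem [simp]: "a \<in> Hmp \<Longrightarrow> W a \<in> Hpm"
  using W_img by blast

text \<open>For \<open>f\<close> in \<open>DA\<close> the left side of Green's identity vanishes
  against every \<open>g\<close> in \<open>Dst\<close>. Since \<open>W (G g)\<close> exhausts
  \<open>Hpm\<close>, nondegeneracy of the pairing gives the claim.\<close>

lemma G_DA: "f \<in> DA \<Longrightarrow> G f = 0"
proof (rule pairing_nondegenerate[OF dual pair])
  assume f: "f \<in> DA"
  then show "G f \<in> Hmp" using adj_A by simp
  fix k assume "k \<in> Hpm"
  then have "k \<in> W ` G ` Dst" by (simp add: G_img W_img)
  then obtain g where g: "g \<in> Dst" "k = W (G g)" by blast
  then show "p (G f) k = 0" using green[OF adj_A(1)[OF f] g(1)] adjD[OF g(1) f] f adj_A by simp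
qed

lemma S_Ms: "S (Ms \<psi>) = (\<i> *\<^sub>C Ast (snd \<psi>), - (\<i> *\<^sub>C Ast (fst \<psi>)))"
  by (simp add: Mst_def)

lemma Ms_lin: "clinear_on M2 Ms"
  unfolding clinear_on_def Mst_dom_def
proof (intro conjI ballI allI)
  note lin = clinear_on_mem[OF inv_S_lin csubspace_UNIV]
  fix x y :: "'x \<times> 'x" assume "x \<in> Dst \<times> Dst" "y \<in> Dst \<times> Dst"
  then show "Ms (x + y) = Ms x + Ms y"
    by (simp add: Mst_def mem_Times_iff adj_add cscale_add_right flip: lin(1))
next
  note lin = clinear_on_mem[OF inv_S_lin csubspace_UNIV]
  fix x :: "'x \<times> 'x" and c assume "x \<in> Dst \<times> Dst"
  then show "Ms (c *\<^sub>C x) = c *\<^sub>C Ms x"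
    by (simp add: Mst_def mem_Times_iff adj_scale cscale_cscale cscale_Pair mult.commute flip: lin(2))
qed

text \<open>This is \<open>(\<Gamma>\<^sub>0 \<psi>, \<i> \<Gamma>\<^sub>1 \<psi>)\<close>, so it lies in \<open>\<Phi>\<close> iff \<open>(\<Gamma>\<^sub>0 \<psi>, \<Gamma>\<^sub>1 \<psi>)\<close> lies in \<open>\<Theta>\<close>.\<close>

definition bdry :: "'x \<times> 'x \<Rightarrow> 'h \<times> 'h" where
  "bdry \<psi> = (G (snd \<psi>), - W (G (fst \<psi>)))"

lemma bdry_mem: "\<psi> \<in> M2 \<Longrightarrow> bdry \<psi> \<in> Hmp \<times> Hpm"
  by (auto simp: bdry_def Mst_dom_def)

lemma bdry_lin: "clinear_on M2 bdry"
  unfolding clinear_on_def Mst_dom_def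
  by (simp add: bdry_def mem_Times_iff clinear_on_add[OF G_lin csubspace_Dst] clinear_on_scale[OF G_lin csubspace_Dst]
      clinear_on_add[OF W_lin Hmp.subspace] clinear_on_scale[OF W_lin Hmp.subspace] cscale_Pair)

lemma bdry_surj:
  assumes "u \<in> Hmp \<times> Hpm"
  obtains \<psi> where "\<psi> \<in> M2" "bdry \<psi> = u"
proof -
  have "fst u \<in> G ` Dst" "- snd u \<in> W ` G ` Dst" using assms by (auto simp: G_img W_img)
  then obtain f g where "f \<in> Dst" "G f = fst u" "g \<in> Dst" "W (G g) = - snd u" by force
  then have "(g, f) \<in> M2" "bdry (g, f) = u" by (auto simp: Mst_dom_def bdry_def)
  with that show ?thesis by blast
qed

text \<open>The weight cancels, as \<open>S\<close> is applied to \<open>inv S\<close>; what remains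
  is a combination of inner products with \<open>Ast\<close>, to which Green's identity applies with
  the second component of \<open>\<psi>\<close> first.\<close>

lemma Ms_form:
  assumes "\<psi> \<in> M2"
  shows "Im (ipS ipX S (Ms \<psi>) \<psi>) = - Re (cnj (p (fst (bdry \<psi>)) (snd (bdry \<psi>))))"
proof -
  obtain f g where \<psi>: "\<psi> = (f, g)" and f: "f \<in> Dst" and g: "g \<in> Dst"
    using assms by (auto simp: Mst_dom_def)
  have "p (G g) (- W (G f)) = - (ipX (Ast g) f - ipX g (Ast f))"
    using f g by (simp add: p_uminus_right green)
  then have "Re (cnj (p (fst (bdry \<psi>)) (snd (bdry \<psi>)))) = Re (ipX g (Ast f)) - Re (ipX (Ast g) f)"
    by (simp add: bdry_def \<psi>)
  moreover have "ipS ipX S (Ms \<psi>) \<psi> = \<i> * (ipX (Ast g) f - ipX (Ast f) g)"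
    unfolding ipS_def S_Ms by (simp add: \<psi> ip2_def algebra_simps)
  moreover have "Re (ipX (Ast f) g) = Re (ipX g (Ast f))"
    using X.ip_cnj[of "Ast f" g] by simp
  ultimately show ?thesis by simp
qed

definition restr :: "('h \<times> 'h) set \<Rightarrow> (('x \<times> 'x) \<times> ('x \<times> 'x)) set" where
  "restr \<Phi> = {(\<psi>, Ms \<psi>) | \<psi>. \<psi> \<in> M2 \<and> bdry \<psi> \<in> \<Phi>}"

text \<open>A left inverse of \<open>restr\<close> on subsets of \<open>Hmp \<times> Hpm\<close>,
  because \<open>bdry\<close> is onto. In the other order only
  \<open>R \<subseteq> restr (bdry_values R)\<close> is general for restrictions of
  \<open>M*\<close>; maximality supplies the equality.\<close>

definition bdry_values :: "(('x \<times> 'x) \<times> ('x \<times> 'x)) set \<Rightarrow> ('h \<times> 'h) set" where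
  "bdry_values R = {bdry \<psi> | \<psi>. \<psi> \<in> M2 \<and> (\<psi>, Ms \<psi>) \<in> R}"

abbreviation "grMs \<equiv> {(\<psi>, Ms \<psi>) | \<psi>. \<psi> \<in> M2}"
abbreviation "grM \<equiv> {(\<psi>, Ms \<psi>) | \<psi>. \<psi> \<in> DA \<times> DA}"

lemma DA_M2: "\<psi> \<in> DA \<times> DA \<Longrightarrow> \<psi> \<in> M2" and bdry_DA: "\<psi> \<in> DA \<times> DA \<Longrightarrow> bdry \<psi> = 0"
  using clinear_on_zero[OF W_lin Hmp.subspace] by (auto simp: Mst_dom_def adj_A bdry_def G_DA zero_prod_def)

lemma bdry_valuesI: "\<psi> \<in> M2 \<Longrightarrow> (\<psi>, Ms \<psi>) \<in> R \<Longrightarrow> bdry \<psi> \<in> bdry_values R"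
  unfolding bdry_values_def by blast

lemma bdry_values_restr: "\<Phi> \<subseteq> Hmp \<times> Hpm \<Longrightarrow> bdry_values (restr \<Phi>) = \<Phi>"
proof (intro equalityI subsetI)
  fix u assume "\<Phi> \<subseteq> Hmp \<times> Hpm" "u \<in> \<Phi>"
  moreover from this obtain \<psi> where "\<psi> \<in> M2" "bdry \<psi> = u" using bdry_surj by blast
  ultimately show "u \<in> bdry_values (restr \<Phi>)" unfolding bdry_values_def restr_def by blast
qed (auto simp: bdry_values_def restr_def)

lemma subset_restr_bdry_values: "R \<subseteq> grMs \<Longrightarrow> R \<subseteq> restr (bdry_values R)"
  unfolding bdry_values_def restr_def by blast

lemma restr_mono: "\<Phi> \<subseteq> \<Psi> \<Longrightarrow> restr \<Phi> \<subseteq> restr \<Psi>"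
  and bdry_values_mono: "R \<subseteq> R' \<Longrightarrow> bdry_values R \<subseteq> bdry_values R'"
  by (auto simp: restr_def bdry_values_def)

lemma grM_restr: "csubspace \<Phi> \<Longrightarrow> grM \<subseteq> restr \<Phi>"
  using csubspace_zero DA_M2 bdry_DA unfolding restr_def by fastforce

lemma dissipative_restr:
  assumes "linrel Hmp Hpm \<Phi>" "accretive_rel p \<Phi>"
  shows "Y.dissipative_rel (restr \<Phi>)"
proof -
  have \<Phi>: "csubspace \<Phi>" "\<Phi> \<subseteq> Hmp \<times> Hpm" using assms by (auto simp: linrel_def)
  note lin = clinear_on_mem[OF bdry_lin csubspace_M2] and linM = clinear_on_mem[OF Ms_lin csubspace_M2]
    and sub = csubspace_mem[OF csubspace_M2] csubspace_mem[OF \<Phi>(1)]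
  have "csubspace (restr \<Phi>)"
    unfolding csubspace_def
  proof (intro conjI ballI allI)
    have "(0, Ms 0) \<in> restr \<Phi>" unfolding restr_def using sub lin(3) by fastforce
    then show "0 \<in> restr \<Phi>" using linM(3) by (simp add: zero_prod_def)
    fix x c assume "x \<in> restr \<Phi>"
    then obtain u where u: "u \<in> M2" "bdry u \<in> \<Phi>" "x = (u, Ms u)" by (auto simp: restr_def)
    then have "c *\<^sub>C x = (c *\<^sub>C u, Ms (c *\<^sub>C u))" "c *\<^sub>C u \<in> M2" "bdry (c *\<^sub>C u) \<in> \<Phi>"
      by (simp_all add: cscale_Pair linM lin sub)
    then show "c *\<^sub>C x \<in> restr \<Phi>" unfolding restr_def by blast
    fix y assume "y \<in> restr \<Phi>"
    then obtain v where v: "v \<in> M2" "bdry v \<in> \<Phi>" "y = (v, Ms v)" by (auto simp: restr_def)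
    with u have "x + y = (u + v, Ms (u + v))" "u + v \<in> M2" "bdry (u + v) \<in> \<Phi>"
      by (simp_all add: linM lin sub)
    then show "x + y \<in> restr \<Phi>" unfolding restr_def by blast
  qed
  moreover have "Im (ipS ipX S (snd u) (fst u)) \<le> 0" if u: "u \<in> restr \<Phi>" for u
  proof -
    obtain \<psi> where \<psi>: "\<psi> \<in> M2" "bdry \<psi> \<in> \<Phi>" "u = (\<psi>, Ms \<psi>)" using u unfolding restr_def by blast
    then have "0 \<le> Re (cnj (p (fst (bdry \<psi>)) (snd (bdry \<psi>))))"
      using assms(2) unfolding accretive_rel_def by (metis (no_types, lifting) case_prod_beta)
    then show ?thesis using Ms_form[OF \<psi>(1)] \<psi>(3) by simp
  qed
  ultimately show ?thesis unfolding Y.dissipative_rel_def by (simp add: split_beta)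
qed

lemma accretive_bdry_values:
  assumes "Y.dissipative_rel R"
  shows "linrel Hmp Hpm (bdry_values R)" "accretive_rel p (bdry_values R)"
proof -
  have R: "csubspace R" using assms by (auto simp: Y.dissipative_rel_def)
  note lin = clinear_on_mem[OF bdry_lin csubspace_M2] and linM = clinear_on_mem[OF Ms_lin csubspace_M2]
    and sub = csubspace_mem[OF csubspace_M2]
  have "csubspace (bdry_values R)"
    unfolding csubspace_def
  proof (intro conjI ballI allI)
    have "(0, Ms 0) \<in> R" using csubspace_zero[OF R] linM(3) by (simp add: zero_prod_def)
    then show "0 \<in> bdry_values R" using bdry_valuesI[of 0 R] sub(1) lin(3) by simp
    fix x c assume "x \<in> bdry_values R"
    then obtain u where u: "u \<in> M2" "(u, Ms u) \<in> R" "x = bdry u" by (auto simp: bdry_values_def)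
    have "(c *\<^sub>C u, Ms (c *\<^sub>C u)) \<in> R"
      using csubspace_scale[OF R u(2), of c] u(1) by (simp add: cscale_Pair linM)
    then show "c *\<^sub>C x \<in> bdry_values R"
      using bdry_valuesI[of "c *\<^sub>C u" R] u by (simp add: lin sub)
    fix y assume "y \<in> bdry_values R"
    then obtain v where v: "v \<in> M2" "(v, Ms v) \<in> R" "y = bdry v" by (auto simp: bdry_values_def)
    have "(u + v, Ms (u + v)) \<in> R"
      using csubspace_add[OF R u(2) v(2)] u(1) v(1) by (simp add: linM)
    then show "x + y \<in> bdry_values R"
      using bdry_valuesI[of "u + v" R] u v by (simp add: lin sub)
  qed
  then show "linrel Hmp Hpm (bdry_values R)" using bdry_mem unfolding linrel_def bdry_values_def by blast
  show "accretive_rel p (bdry_values R)"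
    unfolding accretive_rel_def
  proof
    fix u assume "u \<in> bdry_values R"
    then obtain \<psi> where \<psi>: "\<psi> \<in> M2" "(\<psi>, Ms \<psi>) \<in> R" "u = bdry \<psi>" by (auto simp: bdry_values_def)
    then have "Im (ipS ipX S (Ms \<psi>) \<psi>) \<le> 0" using assms by (auto simp: Y.dissipative_rel_def)
    then show "case u of (h0, h1) \<Rightarrow> 0 \<le> Re (cnj (p h0 h1))"
      using Ms_form[OF \<psi>(1)] \<psi>(3) by (simp add: case_prod_beta)
  qed
qed

text \<open>Replacing \<open>(g, g')\<close> by \<open>(g, g') + t (f, M f)\<close> makes the dissipativity form affine in \<open>t\<close>,
  because \<open>M\<close> is symmetric; being bounded above for all complex \<open>t\<close>, its linear part vanishes.\<close>

lemma dissipative_extension_subset: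
  assumes R: "Y.dissipative_rel R" and M: "grM \<subseteq> R"
  shows "R \<subseteq> grMs"
proof
  fix u assume u: "u \<in> R"
  obtain g g' where gg: "u = (g, g')" by (cases u)
  have sub: "csubspace R" and diss: "\<And>x y. (x, y) \<in> R \<Longrightarrow> Im (ipS ipX S y x) \<le> 0"
    using R by (auto simp: Y.dissipative_rel_def)
  have sym: "ipS ipX S (Ms f) g = ipS ipX S f g'" if f: "f \<in> DA \<times> DA" for f
  proof -
    have fM: "f \<in> M2" "bdry f = 0" using f DA_M2 bdry_DA by auto
    have "p 0 0 = 0" using p_scale_left[of 0 0 0] by simp
    \<comment> \<open>The boundary values of \<open>f\<close> vanish, so the form of
      \<open>M\<close> is real at \<open>f\<close>; this removes the term that is quadratic in
      \<open>t\<close>.\<close>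
    then have real: "Im (ipS ipX S (Ms f) f) = 0" using Ms_form[OF fM(1)] fM(2) by simp
    define d where "d = ipS ipX S (Ms f) g - ipS ipX S f g'"
    have le: "Im (t * d) \<le> - Im (ipS ipX S g' g)" for t
    proof -
      have "(f, Ms f) \<in> R" using M f by blast
      then have "(g, g') + t *\<^sub>C (f, Ms f) \<in> R"
        using u gg sub csubspace_add csubspace_scale by metis
      then have "Im (ipS ipX S (g' + t *\<^sub>C Ms f) (g + t *\<^sub>C f)) \<le> 0"
        by (intro diss) (simp add: cscale_Pair)
      moreover have "ipS ipX S (g' + t *\<^sub>C Ms f) (g + t *\<^sub>C f) =
          ipS ipX S g' g + cnj t * ipS ipX S g' f + t * ipS ipX S (Ms f) g
          + t * cnj t * ipS ipX S (Ms f) f"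
        by (simp add: algebra_simps)
      then have "Im (ipS ipX S (g' + t *\<^sub>C Ms f) (g + t *\<^sub>C f)) =
          Im (ipS ipX S g' g) + Im (cnj t * ipS ipX S g' f) + Im (t * ipS ipX S (Ms f) g)
          + Im (t * cnj t * ipS ipX S (Ms f) f)"
        by (simp only: plus_complex.simps)
      moreover have "Im (t * cnj t * ipS ipX S (Ms f) f) = 0"
        using real by (simp add: complex_mult_cnj)
      moreover have "Im (cnj t * ipS ipX S g' f) = - Im (t * ipS ipX S f g')"
        using Y.ip_cnj[of f g'] by simp
      moreover have "Im (t * d) = Im (t * ipS ipX S (Ms f) g) - Im (t * ipS ipX S f g')"
        by (simp only: d_def right_diff_distrib minus_complex.simps)
      ultimately show ?thesis by linarith
    qed
    have "d = 0"
    proof (rule ccontr)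
      assume "d \<noteq> 0"
      then have pos: "(cmod d)\<^sup>2 > 0" by simp
      \<comment> \<open>For \<open>t = s \<i> cnj d\<close> the left side of \<open>le\<close> is
        \<open>s * (cmod d)\<^sup>2\<close>. This \<open>s\<close> makes it one more than the
        absolute value of the right side.\<close>
      define s where "s = (\<bar>Im (ipS ipX S g' g)\<bar> + 1) / (cmod d)\<^sup>2"
      have "Im (of_real s * \<i> * cnj d * d) = s * (cmod d)\<^sup>2"
        by (simp add: cmod_power2) (simp add: power2_eq_square algebra_simps)
      then have "s * (cmod d)\<^sup>2 \<le> - Im (ipS ipX S g' g)"
        using le[of "of_real s * \<i> * cnj d"] by (simp only:)
      then show False using pos by (simp add: s_def)
    qed
    then show ?thesis by (simp add: d_def)
  qed
  \<comment> \<open>With \<open>S g'\<close> in place of \<open>g'\<close> the identity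
    \<open>sym\<close> is freed from the weight and can be split into components.\<close>
  define \<sigma> where "\<sigma> = S g'"
  have eq: "ip2 ipX (\<i> *\<^sub>C A (snd f), - (\<i> *\<^sub>C A (fst f))) g = ip2 ipX f \<sigma>" if f: "f \<in> DA \<times> DA" for f
  proof -
    have "ipS ipX S (Ms f) g = ip2 ipX (\<i> *\<^sub>C A (snd f), - (\<i> *\<^sub>C A (fst f))) g"
      unfolding ipS_def S_Ms using f by (simp add: adj_A mem_Times_iff)
    moreover have "ipS ipX S f g' = ip2 ipX f \<sigma>" unfolding ipS_def \<sigma>_def by (rule S_sym)
    ultimately show ?thesis using sym[OF f] by simp
  qed
  have sub: "csubspace DA" "clinear_on DA A" using A by (auto simp: closed_dd_symmetric_def)
  note A0 = clinear_on_zero[OF sub(2,1)]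
  \<comment> \<open>As \<open>M\<close> is off-diagonal before the weight, the test vector
    \<open>(f, 0)\<close> reaches the second component of \<open>g\<close>, and
    \<open>(0, f)\<close> below reaches the first; the factors \<open>\<i>\<close> and
    \<open>- \<i>\<close> are then divided out.\<close>
  have 1: "ipX (A f) (snd g) = ipX f (- (\<i> *\<^sub>C fst \<sigma>))" if "f \<in> DA" for f
  proof -
    have "- \<i> * ipX (A f) (snd g) = ipX f (fst \<sigma>)"
      using eq[of "(f, 0)"] that csubspace_zero[OF sub(1)] A0 by (simp add: ip2_def)
    then have "\<i> * (- \<i> * ipX (A f) (snd g)) = \<i> * ipX f (fst \<sigma>)" by simp
    then show ?thesis by simp
  qed
  have 2: "ipX (A f) (fst g) = ipX f (\<i> *\<^sub>C snd \<sigma>)" if "f \<in> DA" for f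
  proof -
    have "\<i> * ipX (A f) (fst g) = ipX f (snd \<sigma>)"
      using eq[of "(0, f)"] that csubspace_zero[OF sub(1)] A0 by (simp add: ip2_def)
    then have "- \<i> * (\<i> * ipX (A f) (fst g)) = - \<i> * ipX f (snd \<sigma>)" by simp
    then show ?thesis by simp
  qed
  have *: "snd g \<in> Dst" "Ast (snd g) = - (\<i> *\<^sub>C fst \<sigma>)" "fst g \<in> Dst" "Ast (fst g) = \<i> *\<^sub>C snd \<sigma>"
    using adjI[of "snd g" "- (\<i> *\<^sub>C fst \<sigma>)"] adjI[of "fst g" "\<i> *\<^sub>C snd \<sigma>"] 1 2 by blast+
  then have "S (Ms g) = \<sigma>"
    unfolding S_Ms by (simp add: cscale_cscale)
  then have "Ms g = g'" using S_bij by (auto simp: \<sigma>_def bij_def dest: injD)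
  moreover have "g \<in> M2" using * by (simp add: Mst_dom_def mem_Times_iff)
  ultimately show "u \<in> grMs" unfolding gg by blast
qed

text \<open>A dissipative relation above \<open>restr \<Phi>\<close> contains \<open>M\<close> and
  so is a restriction of \<open>M*\<close>. Its boundary values form an accretive relation above
  \<open>\<Phi>\<close>, which must equal \<open>\<Phi>\<close>, and a restriction of
  \<open>M*\<close> lies in \<open>restr\<close> of its boundary values.\<close>

lemma max_accretive_imp_max_dissipative:
  assumes "max_accretive_rel Hmp Hpm p \<Phi>"
  shows "Y.max_dissipative_rel (restr \<Phi>)"
  unfolding Y.max_dissipative_rel_def
proof (intro conjI allI impI)
  have \<Phi>: "linrel Hmp Hpm \<Phi>" "accretive_rel p \<Phi>"
    "\<And>\<Psi>. linrel Hmp Hpm \<Psi> \<Longrightarrow> accretive_rel p \<Psi> \<Longrightarrow> \<Phi> \<subseteq> \<Psi> \<Longrightarrow> \<Psi> = \<Phi>"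
    using assms by (auto simp: max_accretive_rel_def)
  then have sub: "\<Phi> \<subseteq> Hmp \<times> Hpm" "csubspace \<Phi>" by (auto simp: linrel_def)
  show "Y.dissipative_rel (restr \<Phi>)" using dissipative_restr \<Phi> by blast
  fix R assume R: "Y.dissipative_rel R \<and> restr \<Phi> \<subseteq> R"
  then have "bdry_values R = \<Phi>"
    using accretive_bdry_values[of R] bdry_values_restr[OF sub(1)] bdry_values_mono[of "restr \<Phi>" R] by (intro \<Phi>(3)) auto
  moreover have "R \<subseteq> grMs"
    by (rule dissipative_extension_subset) (use R grM_restr[OF sub(2)] in \<open>meson order_trans\<close>)+
  ultimately show "R = restr \<Phi>" using R subset_restr_bdry_values[of R] by blast
qed

text \<open>Restricting \<open>M*\<close> by the boundary values of \<open>R\<close> gives a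
  dissipative relation containing \<open>R\<close>, hence \<open>R\<close> itself. A larger
  accretive relation restricts \<open>M*\<close> to a dissipative relation above \<open>R\<close>,
  so to \<open>R\<close> again, and therefore has the same boundary values.\<close>

lemma max_dissipative_imp_max_accretive:
  assumes R: "Y.max_dissipative_rel R" and M: "grM \<subseteq> R"
  shows "max_accretive_rel Hmp Hpm p (bdry_values R)" "R = restr (bdry_values R)"
proof -
  have dis: "Y.dissipative_rel R" and max: "\<And>R'. Y.dissipative_rel R' \<Longrightarrow> R \<subseteq> R' \<Longrightarrow> R' = R"
    using R by (auto simp: Y.max_dissipative_rel_def)
  note acc = accretive_bdry_values[OF dis]
  have sub: "R \<subseteq> restr (bdry_values R)" using subset_restr_bdry_values dissipative_extension_subset[OF dis M] by blast
  show "R = restr (bdry_values R)" using max[OF dissipative_restr[OF acc] sub] by simp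
  have "\<Psi> = bdry_values R" if \<Psi>: "linrel Hmp Hpm \<Psi>" "accretive_rel p \<Psi>" "bdry_values R \<subseteq> \<Psi>" for \<Psi>
  proof -
    have "restr \<Psi> = R" using max[OF dissipative_restr[OF \<Psi>(1,2)]] sub restr_mono[OF \<Psi>(3)] by blast
    then show ?thesis using bdry_values_restr[of \<Psi>] \<Psi>(1) by (auto simp: linrel_def)
  qed
  with acc show "max_accretive_rel Hmp Hpm p (bdry_values R)" unfolding max_accretive_rel_def by blast
qed

lemma m_dissipative_imp_max:
  assumes "m_dissipative (ipS ipX S) R"
  shows "Y.max_dissipative_rel R"
proof -
  obtain l where l: "Im l > 0" "\<And>z. \<exists>x y. (x, y) \<in> R \<and> y - l *\<^sub>C x = z"
    using assms by (auto simp: m_dissipative_def)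
  show ?thesis
    by (rule Y.dissipative_range_imp_max[of R l])
      (use l assms in \<open>auto simp: m_dissipative_def op_graph_def Y.dissipative_rel_def\<close>)
qed

text \<open>Single-valuedness is inherited from \<open>Ms\<close>. The required point of the upper
  half-plane is \<open>\<i>\<close>, where maximality yields surjectivity.\<close>

lemma max_imp_m_dissipative:
  assumes max: "Y.max_dissipative_rel (restr \<Phi>)"
  shows "m_dissipative (ipS ipX S) (restr \<Phi>)"
  unfolding m_dissipative_def
proof (intro conjI allI exI[of _ \<i>])
  have dis: "Y.dissipative_rel (restr \<Phi>)" using max by (simp add: Y.max_dissipative_rel_def)
  show "\<forall>(x, y)\<in>restr \<Phi>. Im (ipS ipX S y x) \<le> 0" using dis unfolding Y.dissipative_rel_def by blast
  have "\<forall>x y z. (x, y) \<in> restr \<Phi> \<and> (x, z) \<in> restr \<Phi> \<longrightarrow> y = z" unfolding restr_def by blast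
  with dis show "op_graph (restr \<Phi>)" unfolding op_graph_def Y.dissipative_rel_def by blast
  fix z
  obtain u where "u \<in> restr \<Phi>" "Y.cayley_map (- \<i>) u = z"
    using Y.max_dissipative_imp_range[OF max, of z] by blast
  then show "\<exists>x y. (x, y) \<in> restr \<Phi> \<and> y - \<i> *\<^sub>C x = z"
    by (intro exI[of _ "fst u"] exI[of _ "snd u"]) (simp add: Y.cayley_map_def)
qed simp

lemma i_uminus_eq_iff: "- (\<i> *\<^sub>C h) = \<i> *\<^sub>C k \<longleftrightarrow> h = - (k :: 'b::cvec)"
proof
  assume "- (\<i> *\<^sub>C h) = \<i> *\<^sub>C k"
  then have "\<i> *\<^sub>C (- (\<i> *\<^sub>C h)) = \<i> *\<^sub>C (\<i> *\<^sub>C k)" by simp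
  then show "h = - k" by (simp add: cscale_cscale)
qed simp

lemma MTheta_eq_restr: "MTheta ipX DA A S G W {(h0, - (\<i> *\<^sub>C h1)) | h0 h1. (h0, h1) \<in> \<Phi>} = restr \<Phi>"
  by (auto simp: MTheta_def restr_def bdry_def i_uminus_eq_iff eq_commute[of "\<i> *\<^sub>C _" "- _"])

lemma MTheta_graph_eq_restr: "MTheta ipX DA A S G W (graph D (\<lambda>h. - (\<i> *\<^sub>C Z h))) = restr (graph D Z)"
proof -
  have "graph D (\<lambda>h. - (\<i> *\<^sub>C Z h)) = {(h0, - (\<i> *\<^sub>C h1)) | h0 h1. (h0, h1) \<in> graph D Z}"
    by (auto simp: graph_def)
  then show ?thesis by (simp only: MTheta_eq_restr)
qed

text \<open>Multiplying by \<open>\<i>\<close> turns \<open>K (g - \<i> h) = g + \<i> h\<close> into the boundary condition.\<close>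

lemma boundary_condition_iff:
  assumes K: "H.contraction K" and h: "h \<in> H" and g: "g \<in> H"
  shows "(h + K h) - \<i> *\<^sub>C (g - K g) = 0 \<longleftrightarrow> (h, g) \<in> H.inv_cayley K"
proof -
  have lin: "clinear_on H K" using K by (simp add: H.contraction_def)
  have "K (g + (- \<i>) *\<^sub>C h) = K g - \<i> *\<^sub>C K h"
    using g h by (simp add: clinear_on_mem[OF lin H.subspace])
  then have "(h, g) \<in> H.inv_cayley K \<longleftrightarrow> K g - \<i> *\<^sub>C K h - (g + \<i> *\<^sub>C h) = 0"
    using g h by (auto simp: H.inv_cayley_def H.cayley_map_def)
  also have "\<dots> \<longleftrightarrow> \<i> *\<^sub>C (K g - \<i> *\<^sub>C K h - (g + \<i> *\<^sub>C h)) = 0" by simp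
  also have "\<i> *\<^sub>C (K g - \<i> *\<^sub>C K h - (g + \<i> *\<^sub>C h)) = (h + K h) - \<i> *\<^sub>C (g - K g)"
    by (simp add: cvec.scale_right_diff_distrib cscale_add_right cscale_cscale)
  finally show ?thesis by simp
qed

lemma to_H_bdry: "\<psi> \<in> M2 \<Longrightarrow> to_H (bdry \<psi>) = (inv_into H V (G (snd \<psi>)), Vsharp (\<i> *\<^sub>C W (G (fst \<psi>))))"
  by (auto simp: to_H_def bdry_def Vi_def Mst_dom_def clinear_on_scale[OF Vsharp_lin Hpm.subspace]
      clinear_on_uminus[OF Vsharp_lin Hpm.subspace])

lemma boundary_condition_restr:
  assumes K: "H.contraction K"
  shows "{(\<psi>, Ms \<psi>) | \<psi>. \<psi> \<in> M2 \<and>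
           (let h = inv_into H V (G (snd \<psi>)); g = Vsharp (\<i> *\<^sub>C W (G (fst \<psi>)))
            in (h + K h) - \<i> *\<^sub>C (g - K g) = 0)} = restr (pullback (H.inv_cayley K))"
proof -
  have "(let h = inv_into H V (G (snd \<psi>)); g = Vsharp (\<i> *\<^sub>C W (G (fst \<psi>)))
            in (h + K h) - \<i> *\<^sub>C (g - K g) = 0) \<longleftrightarrow> bdry \<psi> \<in> pullback (H.inv_cayley K)" if \<psi>: "\<psi> \<in> M2" for \<psi>
    using boundary_condition_iff[OF K, of "fst (to_H (bdry \<psi>))" "snd (to_H (bdry \<psi>))"] to_H_mem[OF bdry_mem[OF \<psi>]]
      bdry_mem[OF \<psi>] to_H_bdry[OF \<psi>] by (simp add: pullback_def Let_def)
  then show ?thesis unfolding restr_def by blast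
qed

text \<open>Under \<open>to_H\<close> the point of the graph over \<open>V f\<close> becomes
  \<open>(f, T f)\<close> with \<open>T = - \<i> V# Z V\<close>. Membership in the inverse Cayley
  transform then reads \<open>K (T f - \<i> f) = T f + \<i> f\<close>, which says that
  \<open>K\<close> extends the Cayley transform of \<open>T\<close>.\<close>

lemma graph_subset_pullback_iff:
  assumes "D \<subseteq> Hmp" "Z ` D \<subseteq> Hpm"
  shows "graph D Z \<subseteq> pullback (H.inv_cayley K) \<longleftrightarrow>
    (\<forall>f\<in>H. V f \<in> D \<longrightarrow> K (- (\<i> *\<^sub>C Vsharp (Z (V f))) - \<i> *\<^sub>C f) = - (\<i> *\<^sub>C Vsharp (Z (V f))) + \<i> *\<^sub>C f)"
proof -
  have iff: "(V f, Z (V f)) \<in> pullback (H.inv_cayley K) \<longleftrightarrow>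
      K (- (\<i> *\<^sub>C Vsharp (Z (V f))) - \<i> *\<^sub>C f) = - (\<i> *\<^sub>C Vsharp (Z (V f))) + \<i> *\<^sub>C f"
    if "f \<in> H" "V f \<in> D" for f
  proof -
    have "Z (V f) \<in> Hpm" using that assms by blast
    with that show ?thesis by (simp add: pullback_def H.inv_cayley_def H.cayley_map_def to_H_def)
  qed
  have graph_eq: "graph D Z = {(V f, Z (V f)) | f. f \<in> H \<and> V f \<in> D}"
  proof (intro equalityI subsetI)
    fix u assume "u \<in> graph D Z"
    then obtain x where x: "x \<in> D" "u = (x, Z x)" by (auto simp: graph_def)
    then have "Vi x \<in> H" "V (Vi x) = x" using assms(1) by auto
    with x show "u \<in> {(V f, Z (V f)) | f. f \<in> H \<and> V f \<in> D}" by force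
  qed (auto simp: graph_def)
  have "graph D Z \<subseteq> pullback (H.inv_cayley K) \<longleftrightarrow>
      (\<forall>f\<in>H. V f \<in> D \<longrightarrow> (V f, Z (V f)) \<in> pullback (H.inv_cayley K))"
    unfolding graph_eq by blast
  with iff show ?thesis by simp
qed

end

theorem theorem7p6:
  fixes ipX :: "'x::cvec \<Rightarrow> 'x \<Rightarrow> complex"
    and DA :: "'x set" and A :: "'x \<Rightarrow> 'x"
    and S :: "'x \<times> 'x \<Rightarrow> 'x \<times> 'x"
    and H Hmp Hpm :: "'h::cvec set"
    and ipH ipmp ippm p :: "'h \<Rightarrow> 'h \<Rightarrow> complex"
    and G :: "'x \<Rightarrow> 'h" and W :: "'h \<Rightarrow> 'h"
    and DZ :: "'h set" and Z :: "'h \<Rightarrow> 'h"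
    and V :: "'h \<Rightarrow> 'h"
    and Mhat :: "(('x \<times> 'x) \<times> ('x \<times> 'x)) set"
  assumes X: "hilbert_space UNIV ipX"
    and A: "closed_dd_symmetric ipX DA A"
    and S: "bdd_unif_pos_sa ipX S"
    and dual: "mixed_duality H ipH Hmp ipmp Hpm ippm"
    and pair: "duality_pairing H ipH Hmp ipmp Hpm ippm p"
    and red: "reduction_tuple ipX DA A Hmp ipmp Hpm ippm p G W"
    and Z: "impedance_op Hmp Hpm p DZ Z"
    and V: "lin_homeo ipH H ipmp Hmp V"
  shows "(m_dissipative (ipS ipX S) Mhat
            \<and> MTheta ipX DA A S G W (graph DZ (\<lambda>h. - (\<i> *\<^sub>C Z h))) \<subseteq> Mhat
          \<longleftrightarrow> (\<exists>\<Phi>. max_accretive_rel Hmp Hpm p \<Phi> \<and> graph DZ Z \<subseteq> \<Phi>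
                 \<and> Mhat = MTheta ipX DA A S G W {(h0, - (\<i> *\<^sub>C h1)) | h0 h1. (h0, h1) \<in> \<Phi>}))
       \<and> (m_dissipative (ipS ipX S) Mhat
            \<and> MTheta ipX DA A S G W (graph DZ (\<lambda>h. - (\<i> *\<^sub>C Z h))) \<subseteq> Mhat
          \<longleftrightarrow> (\<exists>K. K ` H \<subseteq> H \<and> clinear_on H K \<and> (\<forall>h\<in>H. ipnorm ipH (K h) \<le> ipnorm ipH h)
                 \<and> (\<forall>f\<in>H. V f \<in> DZ \<longrightarrow>
                      K (- (\<i> *\<^sub>C vsharp H ipH p V (Z (V f))) - \<i> *\<^sub>C f)
                        = - (\<i> *\<^sub>C vsharp H ipH p V (Z (V f))) + \<i> *\<^sub>C f)
                 \<and> Mhat = {(\<psi>, Mst ipX DA A S \<psi>) | \<psi>. \<psi> \<in> Mst_dom ipX DA A \<and>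
                      (let h = inv_into H V (G (snd \<psi>));
                           g = vsharp H ipH p V (\<i> *\<^sub>C W (G (fst \<psi>)))
                       in (h + K h) - \<i> *\<^sub>C (g - K g) = 0)}))"
    (is "(?i \<longleftrightarrow> ?ii) \<and> (_ \<longleftrightarrow> ?iii)")
proof -
  interpret reduced ipX S H Hmp Hpm ipH ipmp ippm p V DA A G W
    by unfold_locales (fact X S dual pair V A red)+
  have DZ: "DZ \<subseteq> Hmp" "Z ` DZ \<subseteq> Hpm" and Zsub: "csubspace DZ" "clinear_on DZ Z"
    using Z by (auto simp: impedance_op_def)
  have grZ_sub: "graph DZ Z \<subseteq> Hmp \<times> Hpm" using DZ by (auto simp: graph_def)
  have "0 \<in> graph DZ Z"
    using csubspace_zero[OF Zsub(1)] clinear_on_zero[OF Zsub(2,1)] by (auto simp: graph_def zero_prod_def)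
  \<comment> \<open>Every extension of the given restriction thus also extends \<open>M\<close>, as
    the inclusion in \<open>M*\<close> requires.\<close>
  then have grM: "grM \<subseteq> restr (graph DZ Z)"
    using DA_M2 bdry_DA unfolding restr_def by fastforce
  \<comment> \<open>Each of the three conditions is reduced to the existence of a
    \<open>\<Phi>\<close> with this property.\<close>
  define Q where "Q \<Phi> \<longleftrightarrow> max_accretive_rel Hmp Hpm p \<Phi> \<and> graph DZ Z \<subseteq> \<Phi> \<and> Mhat = restr \<Phi>" for \<Phi>
  have i: "?i \<longleftrightarrow> (\<exists>\<Phi>. Q \<Phi>)"
    unfolding MTheta_graph_eq_restr
  proof
    assume i: "m_dissipative (ipS ipX S) Mhat \<and> restr (graph DZ Z) \<subseteq> Mhat"
    note max = max_dissipative_imp_max_accretive[OF m_dissipative_imp_max[OF conjunct1[OF i]]]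
    have "graph DZ Z \<subseteq> bdry_values Mhat" using bdry_values_mono[OF conjunct2[OF i]] bdry_values_restr[OF grZ_sub] by simp
    then show "\<exists>\<Phi>. Q \<Phi>" using max i grM unfolding Q_def by blast
  next
    assume "\<exists>\<Phi>. Q \<Phi>"
    then obtain \<Phi> where "max_accretive_rel Hmp Hpm p \<Phi>" "graph DZ Z \<subseteq> \<Phi>" "Mhat = restr \<Phi>"
      unfolding Q_def by blast
    then show "m_dissipative (ipS ipX S) Mhat \<and> restr (graph DZ Z) \<subseteq> Mhat"
      using max_imp_m_dissipative max_accretive_imp_max_dissipative restr_mono by blast
  qed
  have ii: "?ii \<longleftrightarrow> (\<exists>\<Phi>. Q \<Phi>)"
    unfolding MTheta_eq_restr Q_def ..
  \<comment> \<open>The boundary condition is rewritten as a relation only under the assumption that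
    \<open>K\<close> is a contraction, so the equality of the two graphs has to be used
    conditionally.\<close>
  have eqv: "(K ` H \<subseteq> H \<and> clinear_on H K \<and> (\<forall>h\<in>H. ipnorm ipH (K h) \<le> ipnorm ipH h) \<and> P \<and> Mhat = R)
      \<longleftrightarrow> H.contraction K \<and> P \<and> Mhat = R'" if "H.contraction K \<Longrightarrow> R = R'" for K P R R'
    using that unfolding H.contraction_def by blast
  have "?iii \<longleftrightarrow> (\<exists>K. H.contraction K \<and> graph DZ Z \<subseteq> pullback (H.inv_cayley K) \<and> Mhat = restr (pullback (H.inv_cayley K)))"
    unfolding graph_subset_pullback_iff[OF DZ] by (intro ex_cong1 eqv boundary_condition_restr)
  also have "\<dots> \<longleftrightarrow> (\<exists>\<Phi>. Q \<Phi>)"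
  proof
    assume "\<exists>K. H.contraction K \<and> graph DZ Z \<subseteq> pullback (H.inv_cayley K) \<and> Mhat = restr (pullback (H.inv_cayley K))"
    then show "\<exists>\<Phi>. Q \<Phi>"
      using max_accretive_pullback H.max_dissipative_inv_cayley unfolding Q_def by blast
  next
    assume "\<exists>\<Phi>. Q \<Phi>"
    then obtain \<Phi> where \<Phi>: "max_accretive_rel Hmp Hpm p \<Phi>" "graph DZ Z \<subseteq> \<Phi>" "Mhat = restr \<Phi>"
      unfolding Q_def by blast
    obtain K where K: "H.contraction K" "to_H ` \<Phi> = H.inv_cayley K"
      using H.max_dissipative_imp_inv_cayley[OF max_dissipative_image[OF \<Phi>(1)]] .
    moreover have "pullback (H.inv_cayley K) = \<Phi>"
      using pullback_image[of \<Phi>] K(2) \<Phi>(1) by (simp add: max_accretive_rel_def linrel_def)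
    ultimately show "\<exists>K. H.contraction K \<and> graph DZ Z \<subseteq> pullback (H.inv_cayley K) \<and> Mhat = restr (pullback (H.inv_cayley K))"
      using \<Phi> by auto
  qed
  finally show ?thesis using i ii by blast
qed

end
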